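(* Let $G$ be a finite simple graph of girth at least $5$ (i.e. $G$ has no cycle of length $3$ or $4$) that contains no odd hole of length at least $9$. Then $\chi(G)\le 1456$. If moreover $G$ contains no $5$-hole, then $\chi(G)\le 4$.
   Context: A hole is an induced cycle of length at least $4$; a $k$-hole is a hole of length $k$; an odd hole is a hole of odd length. $\chi(G)$ denotes the chromatic number of $G$. *)

theory Defs
  imports "Graph_Theory.Graph_Theory" "HOL-Library.Extended_Nat"
begin

text \<open>
  A finite simple graph is a \<^locale>\<open>pair_graph\<close>: a finite loop-free digraph without
  parallel arcs whose arc relation is symmetric, an undirected edge being the two arcs
  \<open>(u,v)\<close> and \<open>(v,u)\<close>.

  In such a digraph \<^const>\<open>pre_digraph.cycle\<close> also admits the closed walk \<open>u, v, u\<close>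
  along a single edge. The cycles of the undirected graph are those of length at least 3,
  given by their lists of arcs, so that the length of the list is the length of the cycle.
\<close>

definition graph_cycle :: "'a pair_pre_digraph \<Rightarrow> ('a \<times> 'a) awalk \<Rightarrow> bool" where
  "graph_cycle G p \<longleftrightarrow> pre_digraph.cycle (with_proj G) p \<and> 3 \<le> length p"

text \<open>The girth of a forest is \<open>\<infinity>\<close>, the infimum of the empty set.\<close>

definition girth :: "'a pair_pre_digraph \<Rightarrow> enat" where
  "girth G = (INF p \<in> {p. graph_cycle G p}. enat (length p))"

text \<open>
  A cycle \<open>p\<close> is induced if the subgraph of \<open>G\<close> induced by the vertices of \<open>p\<close>
  (the tails of its arcs) has no edges other than those of \<open>p\<close>, each taken in both
  directions.
\<close>

definition induced_cycle :: "'a pair_pre_digraph \<Rightarrow> ('a \<times> 'a) awalk \<Rightarrow> bool" where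
  "induced_cycle G p \<longleftrightarrow>
     graph_cycle G p \<and> arcs (with_proj G \<restriction> (fst ` set p)) = set p \<union> (set p)\<inverse>"

definition hole :: "'a pair_pre_digraph \<Rightarrow> ('a \<times> 'a) awalk \<Rightarrow> bool" where
  "hole G p \<longleftrightarrow> induced_cycle G p \<and> 4 \<le> length p"

definition k_hole :: "nat \<Rightarrow> 'a pair_pre_digraph \<Rightarrow> ('a \<times> 'a) awalk \<Rightarrow> bool" where
  "k_hole k G p \<longleftrightarrow> hole G p \<and> length p = k"

definition odd_hole :: "'a pair_pre_digraph \<Rightarrow> ('a \<times> 'a) awalk \<Rightarrow> bool" where
  "odd_hole G p \<longleftrightarrow> hole G p \<and> odd (length p)"

definition proper_coloring :: "'a pair_pre_digraph \<Rightarrow> nat \<Rightarrow> ('a \<Rightarrow> nat) \<Rightarrow> bool" where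
  "proper_coloring G k c \<longleftrightarrow>
     (\<forall>v \<in> pverts G. c v < k) \<and> (\<forall>(u, v) \<in> parcs G. c u \<noteq> c v)"

definition chromatic_number :: "'a pair_pre_digraph \<Rightarrow> nat" where
  "chromatic_number G = (LEAST k. \<exists>c. proper_coloring G k c)"

lemma girth_ge_5_iff:
  "5 \<le> girth G \<longleftrightarrow> \<not> (\<exists>p. graph_cycle G p \<and> (length p = 3 \<or> length p = 4))"
proof -
  have "5 \<le> girth G \<longleftrightarrow> (\<forall>p. graph_cycle G p \<longrightarrow> 5 \<le> length p)"
    by (simp add: girth_def le_INF_iff numeral_eq_enat)
  moreover have "5 \<le> length p \<longleftrightarrow> length p \<noteq> 3 \<and> length p \<noteq> 4" if "graph_cycle G p" for p
    using that by (auto simp: graph_cycle_def)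
  ultimately show ?thesis by blast
qed

text \<open>Finiteness and the absence of loops ensure that the minimum is attained.\<close>

lemma (in pair_graph) ex_chromatic_number_coloring:
  "\<exists>c. proper_coloring G (chromatic_number G) c"
proof -
  obtain c :: "'a \<Rightarrow> nat" and n where c: "c ` pverts G = {i. i < n}" "inj_on c (pverts G)"
    using finite_imp_inj_to_nat_seg[OF pair_finite_verts] by blast
  have "proper_coloring G n c"
    unfolding proper_coloring_def
    using c pair_no_loops in_arcsD1 in_arcsD2 by (fastforce dest: inj_onD)
  then have "\<exists>k c. proper_coloring G k c"
    by blast
  then show ?thesis
    unfolding chromatic_number_def by (rule LeastI_ex)
qed

end

(*
  Sort the vertices by their distance from a root in each component. If every level is n-colourable
  then G is 2n-colourable, so it suffices to colour a level with 728, resp. 2, colours.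

  Every vertex of a level has a parent in the level before, and two parents are joined by an induced
  path R whose interior lies in earlier levels, hence sees nothing of the level itself. Any induced
  path in the level between their children closes up with R to a hole, and if two such induced paths
  have lengths of different parity, then one of the two holes is odd, so it has length at most 7.

  Without 5-holes, an odd hole c0 ... c6 in a level leads to a contradiction with the parents pi and
  grandparents qi: q0 and q2 must be adjacent, and p0 and p3 must be adjacent (otherwise they have a
  common parent q, and q, q2, q4, q6, q1 is a closed walk of length 5). Now p0, p3, p6, c6, c0 is a
  5-cycle. So the levels are bipartite.

  In general, a level that is not 728-colourable contains a subgraph of minimum degree at least 728
  with an odd hole C, and by the girth condition tails can be grown greedily at two nonadjacent
  vertices a, b of C, keeping everything induced. Going round C in both directions provides both
  parities, which forces the parents p, p' of the ends of the tails to be adjacent to b and a and to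
  be joined only by paths R with at most 4 vertices. With 3 ends at one tail and 10 at the other this
  produces a 4-cycle among the grandparents.
*)
theory Submission
  imports Defs
begin

section \<open>Induced paths and holes as lists of vertices: joining, cutting, rotating\<close>

section \<open>Induced paths and cycles\<close>

locale symmetric_relation =
  fixes E :: "'a \<Rightarrow> 'a \<Rightarrow> bool"
  assumes sym: "E x y \<Longrightarrow> E y x"
    and irrefl: "\<not> E x x"
begin

lemma sym_iff: "E x y \<longleftrightarrow> E y x"
  using sym by blast

text \<open>Each vertex is compared with later ones only; symmetry of \<open>E\<close> supplies the
  rest, so the list is a path without chords. For a single vertex the quantifier ranges over the
  empty set, so \<open>hd []\<close> is harmless.\<close>

primrec ipath :: "'a list \<Rightarrow> bool" where
  "ipath [] \<longleftrightarrow> True"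
| "ipath (x # xs) \<longleftrightarrow> ipath xs \<and> x \<notin> set xs \<and> (\<forall>y\<in>set xs. E x y \<longleftrightarrow> y = hd xs)"

text \<open>A hole opened at its first vertex; the lower bound on the length keeps triangles
  out.\<close>

definition icyc :: "'a list \<Rightarrow> bool" where
  "icyc cs \<longleftrightarrow> 4 \<le> length cs \<and> ipath (tl cs) \<and> hd cs \<notin> set (tl cs) \<and>
     (\<forall>y\<in>set (tl cs). E (hd cs) y \<longleftrightarrow> y = hd (tl cs) \<or> y = last (tl cs))"

lemma icyc_Cons:
  "icyc (x # xs) \<longleftrightarrow> 3 \<le> length xs \<and> ipath xs \<and> x \<notin> set xs \<and>
     (\<forall>y\<in>set xs. E x y \<longleftrightarrow> y = hd xs \<or> y = last xs)"
  by (auto simp: icyc_def)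

lemma ipath_distinct: "ipath xs \<Longrightarrow> distinct xs"
  by (induction xs) auto

lemma ipath_append:
  assumes "xs \<noteq> []" "ys \<noteq> []"
  shows "ipath (xs @ ys) \<longleftrightarrow> ipath xs \<and> ipath ys \<and> set xs \<inter> set ys = {} \<and>
    (\<forall>x\<in>set xs. \<forall>y\<in>set ys. E x y \<longleftrightarrow> x = last xs \<and> y = hd ys)"
  using assms(1)
proof (induction xs)
  case (Cons x xs)
  show ?case
  proof (cases "xs = []")
    case True
    then show ?thesis using assms(2) by auto
  next
    case False
    then have ne: "hd xs \<in> set xs" "last xs \<in> set xs" "last (x # xs) = last xs" by auto
    have L: "hd (xs @ ys) = hd xs" using False by simp
    show ?thesis
      unfolding append_Cons ipath.simps L Cons.IH[OF False] ne(3) list.set set_append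
    proof (intro iffI conjI; (elim conjE)?)
      assume *: "set xs \<inter> set ys = {}" "x \<notin> set xs \<union> set ys"
        "\<forall>x\<in>set xs. \<forall>y\<in>set ys. E x y = (x = last xs \<and> y = hd ys)"
        "\<forall>y\<in>set xs \<union> set ys. E x y = (y = hd xs)"
      show "\<forall>x\<in>insert x (set xs). \<forall>y\<in>set ys. E x y = (x = last xs \<and> y = hd ys)"
      proof (intro ballI)
        fix u y assume "u \<in> insert x (set xs)" "y \<in> set ys"
        then show "E u y = (u = last xs \<and> y = hd ys)" using * ne(1,2) by (cases "u = x") auto
      qed
    next
      assume *: "insert x (set xs) \<inter> set ys = {}" "x \<notin> set xs"
        "\<forall>x\<in>insert x (set xs). \<forall>y\<in>set ys. E x y = (x = last xs \<and> y = hd ys)"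
        "\<forall>y\<in>set xs. E x y = (y = hd xs)"
      show "\<forall>y\<in>set xs \<union> set ys. E x y = (y = hd xs)"
      proof
        fix y assume "y \<in> set xs \<union> set ys"
        then show "E x y = (y = hd xs)" using * ne(1,2) by (cases "y \<in> set xs") auto
      qed
    qed auto
  qed
qed simp

lemma ipath_appendD: "ipath (xs @ ys) \<Longrightarrow> ipath xs \<and> ipath ys"
  by (cases "xs = [] \<or> ys = []") (auto simp: ipath_append)

lemma ipath_rev [simp]: "ipath (rev xs) \<longleftrightarrow> ipath xs"
proof (induction xs)
  case (Cons x xs)
  show ?case
  proof (cases "xs = []")
    case False
    then show ?thesis using Cons
      by (subst rev.simps, subst ipath_append) (auto simp: last_rev sym_iff)
  qed simp
qed simp

lemma ipath_edges:
  assumes "ipath xs" "u \<in> set xs" "v \<in> set xs"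
  shows "E u v \<longleftrightarrow> (u, v) \<in> set (zip xs (tl xs)) \<or> (v, u) \<in> set (zip xs (tl xs))"
  using assms
proof (induction xs)
  case (Cons x xs)
  show ?case
  proof (cases xs)
    case Nil
    then show ?thesis using Cons.prems irrefl by simp
  next
    case (Cons y ys)
    have z: "zip (x # xs) (tl (x # xs)) = (x, y) # zip xs (tl xs)" using Cons by simp
    have s: "set (zip xs (tl xs)) \<subseteq> set xs \<times> set xs"
      using set_zip_leftD set_zip_rightD list.set_sel(2) Cons by fastforce
    have x: "x \<notin> set xs" "\<forall>w\<in>set xs. E x w \<longleftrightarrow> w = y" "ipath xs" using Cons.prems Cons by auto
    consider "u \<in> set xs" "v \<in> set xs" | "u = x" "v = x" | "u = x" "v \<in> set xs" | "u \<in> set xs" "v = x"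
      using Cons.prems by auto
    then show ?thesis
    proof cases
      case 1
      then have "u \<noteq> x" "v \<noteq> x" using x(1) by auto
      then show ?thesis unfolding z using Cons.IH[OF x(3) 1] by auto
    next
      case 2
      then show ?thesis unfolding z using irrefl s x(1) Cons by auto
    next
      case 3
      then have "v \<noteq> x" using x(1) by auto
      then show ?thesis unfolding z using 3 x s by auto
    next
      case 4
      then have "u \<noteq> x" using x(1) by auto
      then show ?thesis unfolding z using 4 x s sym_iff[of u x] by auto
    qed
  qed
qed simp

text \<open>Dropping the first vertex of \<open>xs\<close> leaves an induced path that runs along
  the rest of \<open>xs\<close> and back along \<open>ys\<close>; its two ends are exactly the
  neighbours of the dropped vertex.\<close>

lemma icyc_join:
  assumes "ipath xs" "ipath ys" "xs \<noteq> []" "ys \<noteq> []" "4 \<le> length xs + length ys"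
    and "2 \<le> length xs"
    and "set xs \<inter> set ys = {}"
    and "\<And>x y. x \<in> set xs \<Longrightarrow> y \<in> set ys \<Longrightarrow>
           E x y \<longleftrightarrow> x = hd xs \<and> y = hd ys \<or> x = last xs \<and> y = last ys"
  shows "icyc (xs @ rev ys)"
proof -
  obtain x xs' where xs: "xs = x # xs'" using assms(3) by (cases xs) auto
  have ne: "xs' \<noteq> []" using assms(6) xs by auto
  have x: "x \<notin> set xs'" "ipath xs'" "\<forall>y\<in>set xs'. E x y \<longleftrightarrow> y = hd xs'"
    using assms(1) xs by auto
  have lx: "last xs = last xs'" "last xs' \<in> set xs'" using ne xs by auto
  have "ipath (xs' @ rev ys)"
    using x assms lx ne by (subst ipath_append) (auto simp: xs hd_rev)
  moreover have "hd ys \<in> set ys" "hd xs' \<in> set xs'" using assms(4) ne by auto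
  ultimately show ?thesis using assms x ne lx
    by (auto simp: xs icyc_Cons last_rev hd_append)
qed

lemma icyc_snoc:
  assumes "ipath xs" "3 \<le> length xs" "p \<notin> set xs"
    and "\<And>x. x \<in> set xs \<Longrightarrow> E p x \<longleftrightarrow> x = hd xs \<or> x = last xs"
  shows "icyc (p # xs)"
  using assms by (auto simp: icyc_Cons)

lemma icyc_rotate:
  assumes "icyc (x # xs)"
  shows "icyc (xs @ [x])"
proof -
  have "icyc (xs @ rev [x])"
    using assms by (intro icyc_join) (auto simp: icyc_Cons sym_iff)
  then show ?thesis by simp
qed

lemma icyc_rotate_append:
  "icyc (xs @ ys) \<Longrightarrow> icyc (ys @ xs)"
proof (induction xs arbitrary: ys)
  case (Cons x xs)
  from icyc_rotate[of x "xs @ ys"] Cons.prems have "icyc (xs @ (ys @ [x]))" by simp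
  from Cons.IH[OF this] show ?case by simp
qed simp

lemma icyc_rev: "icyc (x # xs) \<Longrightarrow> icyc (x # rev xs)"
  unfolding icyc_Cons by (cases "xs = []") (auto simp: hd_rev last_rev)

text \<open>These are the two arcs of the hole between nonadjacent vertices. Both ends are counted
  twice, hence the \<open>+ 2\<close>; on an odd hole the arcs therefore have different
  parities.\<close>

lemma icyc_two_paths:
  assumes "icyc cs" "s \<in> set cs" "b \<in> set cs" "s \<noteq> b" "\<not> E s b"
  shows "\<exists>A B. ipath A \<and> ipath B \<and> A \<noteq> [] \<and> B \<noteq> [] \<and> hd A = s \<and> hd B = s \<and>
     last A = b \<and> last B = b \<and> 3 \<le> length A \<and> 3 \<le> length B \<and>
     set A \<subseteq> set cs \<and> set B \<subseteq> set cs \<and> length A + length B = length cs + 2"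
proof -
  obtain us vs where "cs = us @ s # vs" using assms(2) by (auto dest: split_list)
  then have c: "icyc (s # vs @ us)" "set cs = set (s # vs @ us)"
      "length cs = length (s # vs @ us)"
    using assms(1) icyc_rotate_append[of us "s # vs"] by auto
  have "b \<in> set (vs @ us)" using c assms by auto
  then obtain y1 y2 where y: "vs @ us = y1 @ b # y2" by (meson split_list)
  have r: "icyc (s # rev y2 @ b # rev y1)"
    using icyc_rev[OF c(1)] unfolding y by simp
  have ne: "y1 \<noteq> []" "y2 \<noteq> []" using c(1) assms(5) by (auto simp: icyc_Cons y)
  \<comment> \<open>An arc from \<open>s\<close> to \<open>b\<close> is induced because the second
    neighbour of \<open>s\<close> on the hole lies in the nonempty remainder
    \<open>z2\<close>.\<close>
  have gen: "ipath (s # z1 @ [b])" if "icyc (s # z1 @ b # z2)" "z2 \<noteq> []" for z1 z2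
  proof -
    have z: "ipath (z1 @ b # z2)" "s \<notin> set (z1 @ b # z2)"
      "\<forall>y\<in>set (z1 @ b # z2). E s y \<longleftrightarrow> y = hd (z1 @ b # z2) \<or> y = last z2"
      using that by (auto simp: icyc_Cons)
    have d: "distinct (z1 @ b # z2)" using z(1) by (rule ipath_distinct)
    have "ipath (z1 @ [b])" using z(1) ipath_appendD[of "z1 @ [b]" z2] by simp
    moreover have "hd (z1 @ b # z2) = hd (z1 @ [b])" by (cases z1) auto
    moreover have "last z2 \<notin> set (z1 @ [b])" using d that(2) last_in_set by fastforce
    ultimately show ?thesis using z by auto
  qed
  have "ipath (s # y1 @ [b])" using gen[of y1 y2] c(1) y ne by simp
  moreover have "ipath (s # rev y2 @ [b])" using gen[of "rev y2" "rev y1"] r ne by simp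
  moreover have "set (s # y1 @ [b]) \<subseteq> set cs" "set (s # rev y2 @ [b]) \<subseteq> set cs"
    using c(2) y by auto
  moreover have "length (s # y1 @ [b]) + length (s # rev y2 @ [b]) = length cs + 2"
    using c(3) y by simp
  moreover have "3 \<le> length (s # y1 @ [b])" "3 \<le> length (s # rev y2 @ [b])"
    using ne by (auto simp: Suc_le_eq)
  ultimately show ?thesis
    by (intro exI[of _ "s # y1 @ [b]"] exI[of _ "s # rev y2 @ [b]"]) simp
qed

text \<open>A walk inside \<open>U\<close> is followed edge by edge. Before a new vertex is
  appended, the current path is cut at its first vertex equal or adjacent to the new one, so that no
  chord arises.\<close>

lemma ipath_exists:
  assumes "(a, b) \<in> {(x, y). E x y \<and> x \<in> U \<and> y \<in> U}\<^sup>*" "a \<in> U"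
  shows "\<exists>R. ipath R \<and> R \<noteq> [] \<and> hd R = a \<and> last R = b \<and> set R \<subseteq> U"
  using assms(1)
proof (induction rule: rtrancl_induct)
  case base
  show ?case by (rule exI[of _ "[a]"]) (use assms in auto)
next
  case (step y z)
  then obtain R where R: "ipath R" "R \<noteq> []" "hd R = a" "last R = y" "set R \<subseteq> U" by blast
  have yz: "E y z" "z \<in> U" using step by auto
  have "\<exists>x\<in>set R. x = z \<or> E x z" using R yz last_in_set by blast
  then obtain us x vs where s: "R = us @ x # vs" "x = z \<or> E x z"
      "\<forall>u\<in>set us. \<not> (u = z \<or> E u z)"
    using split_list_first_prop[of R "\<lambda>x. x = z \<or> E x z"] by blast
  have p: "ipath (us @ [x])" using ipath_appendD[of "us @ [x]" vs] R s by simp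
  show ?case
  proof (cases "x = z")
    case True
    then show ?thesis using p R s by (intro exI[of _ "us @ [x]"]) (auto simp: hd_append)
  next
    case False
    have "E x z" using s False by blast
    have "ipath ((us @ [x]) @ [z])"
      using p False s \<open>E x z\<close> by (subst ipath_append) auto
    then show ?thesis using R s yz
      by (intro exI[of _ "us @ [x, z]"]) (auto simp: hd_append)
  qed
qed

lemma ipath_alternating:
  assumes "ipath xs" "xs \<noteq> []" "\<And>v. v \<in> set xs \<Longrightarrow> c v < (2::nat)"
    and "\<And>u v. u \<in> set xs \<Longrightarrow> v \<in> set xs \<Longrightarrow> E u v \<Longrightarrow> c u \<noteq> c v"
  shows "c (hd xs) = c (last xs) \<longleftrightarrow> odd (length xs)"
  using assms
proof (induction xs)
  case (Cons x xs)
  show ?case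
  proof (cases "xs = []")
    case False
    have e: "E x (hd xs)" using Cons.prems(1) False by simp
    have "c (hd xs) = c (last xs) \<longleftrightarrow> odd (length xs)"
      using Cons.IH False Cons.prems by auto
    moreover have "c x < 2" "c (hd xs) < 2" "c (last xs) < 2" "c x \<noteq> c (hd xs)"
      using Cons.prems(3,4) False e by auto
    then have "c x = c (last xs) \<longleftrightarrow> c (hd xs) \<noteq> c (last xs)"
      unfolding less_2_cases_iff by argo
    moreover have "c (hd (x # xs)) = c x" "last (x # xs) = last xs"
        "odd (length (x # xs)) \<longleftrightarrow> even (length xs)"
      using False by auto
    ultimately show ?thesis by argo
  qed simp
qed simp

section \<open>Critical subgraphs, and odd holes in triangle-free graphs that are not
  bipartite\<close>

section \<open>Colourings\<close>

definition colorable :: "'a set \<Rightarrow> nat \<Rightarrow> bool" where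
  "colorable H n \<longleftrightarrow>
     (\<exists>c. (\<forall>v\<in>H. c v < n) \<and> (\<forall>u\<in>H. \<forall>v\<in>H. E u v \<longrightarrow> c u \<noteq> (c v :: nat)))"

lemma colorable_mono: "colorable H m \<Longrightarrow> m \<le> n \<Longrightarrow> colorable H n"
  unfolding colorable_def using order_less_le_trans by blast

lemma critical_subset:
  assumes "finite H" "\<not> colorable H n"
  obtains K where "K \<subseteq> H" "\<not> colorable K n" "\<And>v. v \<in> K \<Longrightarrow> colorable (K - {v}) n"
  using assms
proof (induction H arbitrary: thesis rule: finite_psubset_induct)
  case (psubset H)
  show ?case
  proof (cases "\<forall>v\<in>H. colorable (H - {v}) n")
    case True
    then show ?thesis using psubset.prems by blast
  next
    case False
    then obtain v where "v \<in> H" "\<not> colorable (H - {v}) n" by blast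
    show ?thesis
    proof (rule psubset.IH[of "H - {v}"])
      show "H - {v} \<subset> H" using \<open>v \<in> H\<close> by blast
      show "\<not> colorable (H - {v}) n" by fact
      show thesis if "K \<subseteq> H - {v}" "\<not> colorable K n" "\<And>v. v \<in> K \<Longrightarrow> colorable (K - {v}) n" for K
        using psubset.prems(1)[of K] that by blast
    qed
  qed
qed

text \<open>With fewer than \<open>n\<close> neighbours of \<open>v\<close> in \<open>K\<close>,
  some colour would be free at \<open>v\<close>, and the colouring of the rest would extend.\<close>

lemma critical_degree:
  assumes "finite K" "\<not> colorable K n" "v \<in> K" "colorable (K - {v}) n"
  shows "n \<le> card {w \<in> K. E v w}"
proof (rule ccontr)
  assume "\<not> ?thesis"
  then have d: "card {w \<in> K. E v w} < n" by simp
  obtain c where c: "\<forall>u\<in>K - {v}. c u < n"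
     "\<forall>u\<in>K - {v}. \<forall>w\<in>K - {v}. E u w \<longrightarrow> c u \<noteq> (c w :: nat)"
    using assms(4) unfolding colorable_def by blast
  have "card (c ` {w \<in> K. E v w}) < card {..<n}"
    using d card_image_le[of "{w \<in> K. E v w}" c] assms(1) by simp
  then have "\<not> {..<n} \<subseteq> c ` {w \<in> K. E v w}"
    using card_mono[of "c ` {w \<in> K. E v w}" "{..<n}"] assms(1) by auto
  then obtain x where x: "x < n" "x \<notin> c ` {w \<in> K. E v w}" by auto
  have "colorable K n"
    unfolding colorable_def
    using x c irrefl by (intro exI[of _ "c(v := x)"]) (auto simp: image_iff dest: sym)
  with assms show False by blast
qed

text \<open>The neighbours of \<open>v\<close> cut the path into segments, and some segment has ends
  of different colours. It has an even number of vertices, so \<open>v\<close> closes it to an odd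
  hole. The induction discards the first segment as long as its ends have equal colours.\<close>

lemma icyc_through:
  assumes "ipath xs" "xs \<noteq> []" "v \<notin> set xs" "E v (hd xs)" "E v (last xs)"
    and c: "c (hd xs) \<noteq> (c (last xs) :: nat)" "\<And>u. u \<in> set xs \<Longrightarrow> c u < 2"
      "\<And>u w. u \<in> set xs \<Longrightarrow> w \<in> set xs \<Longrightarrow> E u w \<Longrightarrow> c u \<noteq> c w"
    and no_triangle: "\<And>x y z. E x y \<Longrightarrow> E y z \<Longrightarrow> \<not> E z x"
  shows "\<exists>cs. icyc cs \<and> odd (length cs) \<and> set cs \<subseteq> insert v (set xs)"
  using assms(1-8)
proof (induction "length xs" arbitrary: xs rule: less_induct)
  case less
  obtain a r where xs: "xs = a # r" using less.prems(2) by (cases xs) auto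
  have r: "r \<noteq> []" using less.prems(6) xs by auto
  then have "\<exists>w\<in>set r. E v w" using less.prems(5) xs last_in_set by auto
  then obtain us w ws where w: "r = us @ w # ws" "E v w" "\<forall>u\<in>set us. \<not> E v u"
    using split_list_first_prop[of r "E v"] by blast
  have xs': "xs = (a # us @ [w]) @ ws" "xs = (a # us) @ (w # ws)" using xs w by simp_all
  show ?case
  proof (cases "c w = c a")
    case True
    have "ipath (w # ws)"
      using ipath_appendD[of "a # us" "w # ws"] less.prems(1) unfolding xs'(2) by blast
    moreover have "last (w # ws) = last xs" "hd (w # ws) = w" "length (w # ws) < length xs"
      unfolding xs'(2) by auto
    moreover have "v \<notin> set (w # ws)" "E v (last xs)" "c w \<noteq> c (last xs)"
      using less.prems(3,5,6) xs(1) w(1) True by auto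
    moreover have "u \<in> set xs" if "u \<in> set (w # ws)" for u
      using that unfolding xs'(2) by auto
    ultimately have "\<exists>cs. icyc cs \<and> odd (length cs) \<and> set cs \<subseteq> insert v (set (w # ws))"
      using w(2) less.prems(7,8) by (intro less.hyps) auto
    then show ?thesis unfolding xs'(2) by fastforce
  next
    case False
    let ?P = "a # us @ [w]"
    have P: "ipath ?P" using ipath_appendD[of ?P ws] less.prems(1) unfolding xs'(1) by blast
    have ev: "even (length ?P)"
    proof -
      have "set ?P \<subseteq> set xs" unfolding xs'(1) by auto
      then have "c (hd ?P) = c (last ?P) \<longleftrightarrow> odd (length ?P)"
        using less.prems(7,8) by (intro ipath_alternating[OF P]) blast+
      then show ?thesis using False by simp
    qed
    \<comment> \<open>Without triangles the segment has at least three vertices, so the cycle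
      through \<open>v\<close> is long enough for a hole.\<close>
    have "us \<noteq> []"
    proof
      assume "us = []"
      then have "E a w" using P by simp
      then show False using no_triangle[of v a w] sym w(2) less.prems(4) xs by auto
    qed
    moreover have "E v a" "v \<notin> set ?P" using less.prems(3,4) w xs by auto
    ultimately have "icyc (v # ?P)"
      using P w(2,3) by (intro icyc_snoc) (auto simp: Suc_le_eq)
    then show ?thesis using ev unfolding xs'(1) by (intro exI[of _ "v # ?P"]) auto
  qed
qed

text \<open>In a minimal subset that is not 2-colourable, remove a vertex \<open>v\<close> and
  2-colour the rest. Some component of the rest contains neighbours of \<open>v\<close> of both
  colours, since otherwise swapping colours on whole components would make room for
  \<open>v\<close>. An induced path between two such neighbours goes into
  \<open>icyc_through\<close>.\<close>

lemma odd_icyc_exists: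
  assumes "finite H" "\<not> colorable H 2"
    and no_triangle: "\<And>x y z. E x y \<Longrightarrow> E y z \<Longrightarrow> \<not> E z x"
  shows "\<exists>cs. icyc cs \<and> odd (length cs) \<and> set cs \<subseteq> H"
proof -
  obtain K where K: "K \<subseteq> H" "\<not> colorable K 2" "\<And>v. v \<in> K \<Longrightarrow> colorable (K - {v}) 2"
    using critical_subset[OF assms(1,2)] by blast
  have "K \<noteq> {}" using K(2) by (auto simp: colorable_def)
  then obtain v where v: "v \<in> K" by blast
  define U where "U = K - {v}"
  define r where "r = {(x, y). E x y \<and> x \<in> U \<and> y \<in> U}"
  obtain c :: "'a \<Rightarrow> nat" where c: "\<And>u. u \<in> U \<Longrightarrow> c u < 2"
     "\<And>u w. u \<in> U \<Longrightarrow> w \<in> U \<Longrightarrow> E u w \<Longrightarrow> c u \<noteq> c w"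
    using K(3)[OF v] unfolding colorable_def U_def by blast
  have "sym r" unfolding r_def by (auto intro!: symI sym)
  then have symr: "(y, x) \<in> r\<^sup>*" if "(x, y) \<in> r\<^sup>*" for x y
    using that sym_rtrancl symD by metis
  have "\<exists>a b. a \<in> U \<and> b \<in> U \<and> E v a \<and> E v b \<and> (a, b) \<in> r\<^sup>* \<and> c a \<noteq> c b"
  proof (rule ccontr)
    assume *: "\<not> ?thesis"
    \<comment> \<open>\<open>A u\<close> collects the neighbours of \<open>v\<close> in the
      component of \<open>u\<close>. The recolouring \<open>d\<close> gives all of them colour 1 and
      \<open>v\<close> colour 0, and keeps \<open>c\<close> on components without such neighbours.
      Since \<open>A\<close> is constant on components, so is the representative picked by
      \<open>SOME\<close>.\<close>
    define A where "A u = {a \<in> U. E v a \<and> (a, u) \<in> r\<^sup>*}" for u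
    define d where "d u = (if u = v then 0 else
        if A u = {} then c u else if c u = c (SOME a. a \<in> A u) then 1 else (0::nat))" for u
    have A_eq: "A u = A w" if "u \<in> U" "w \<in> U" "E u w" for u w
    proof -
      have "(u, w) \<in> r" "(w, u) \<in> r" using that sym unfolding r_def by auto
      then show ?thesis unfolding A_def by (auto intro: rtrancl.rtrancl_into_rtrancl)
    qed
    have d1: "d u = 1" if "u \<in> U" "E v u" for u
    proof -
      have "u \<in> A u" using that unfolding A_def by auto
      then have "(SOME a. a \<in> A u) \<in> A u" by (metis someI)
      then have "c (SOME a. a \<in> A u) = c u" using that * unfolding A_def by blast
      then show ?thesis using \<open>u \<in> A u\<close> that unfolding d_def U_def by auto
    qed
    have "d u < 2" if "u \<in> K" for u
      using that c(1) unfolding d_def U_def by auto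
    moreover have "d u \<noteq> d w" if uw: "u \<in> K" "w \<in> K" "E u w" for u w
    proof -
      have "d v = 0" unfolding d_def by simp
      consider "u = v" "w \<in> U" | "w = v" "u \<in> U" | "u \<in> U" "w \<in> U"
        using uw irrefl unfolding U_def by blast
      then show ?thesis
      proof cases
        case 1
        then show ?thesis using d1[of w] \<open>d v = 0\<close> uw by simp
      next
        case 2
        then show ?thesis using d1[of u] \<open>d v = 0\<close> sym[OF uw(3)] by simp
      next
        case 3
        define s where "s = c (SOME a. a \<in> A u)"
        have "s < 2" if "A u \<noteq> {}"
        proof -
          have "(SOME a. a \<in> A u) \<in> A u" using that by (simp add: some_in_eq)
          then show ?thesis unfolding s_def A_def using c(1) by blast
        qed
        moreover have "c u \<noteq> c w" "c u < 2" "c w < 2" using c 3 uw(3) by auto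
        moreover have "u \<noteq> v" "w \<noteq> v" using 3 unfolding U_def by auto
        moreover have "c u = s \<or> c w = s" if "s < 2" "c u \<noteq> c w" "c u < 2" "c w < 2"
          using that by linarith
        ultimately show ?thesis
          unfolding d_def A_eq[OF 3 uw(3), symmetric] s_def[symmetric] by auto
      qed
    qed
    ultimately have "colorable K 2" unfolding colorable_def by blast
    then show False using K by blast
  qed
  then obtain a b where ab: "a \<in> U" "b \<in> U" "E v a" "E v b" "(a, b) \<in> r\<^sup>*" "c a \<noteq> c b"
    by blast
  obtain R where R: "ipath R" "R \<noteq> []" "hd R = a" "last R = b" "set R \<subseteq> U"
    using ipath_exists[of a b U] ab unfolding r_def by blast
  have "\<exists>cs. icyc cs \<and> odd (length cs) \<and> set cs \<subseteq> insert v (set R)"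
  proof (rule icyc_through[where c = c])
    show "v \<notin> set R" using R(5) unfolding U_def by blast
    show "E v (hd R)" "E v (last R)" "c (hd R) \<noteq> c (last R)" using R(3,4) ab by simp_all
  qed (use R(1,2,5) c no_triangle in blast)+
  then show ?thesis using R(5) v K(1) unfolding U_def by blast
qed

section \<open>Breadth-first levels and paths through lower levels\<close>

section \<open>Distance levels\<close>

text \<open>The sphere of radius \<open>k\<close> around \<open>r\<close>; vertices outside the
  component of \<open>r\<close> lie in no level.\<close>

definition lev :: "'a \<Rightarrow> nat \<Rightarrow> 'a set" where
  "lev r k = {v. (r, v) \<in> {(x, y). E x y} ^^ k \<and> (\<forall>j<k. (r, v) \<notin> {(x, y). E x y} ^^ j)}"

definition below :: "'a \<Rightarrow> nat \<Rightarrow> 'a set" where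
  "below r k = (\<Union>j<k. lev r j)"

lemma lev_0 [simp]: "lev r 0 = {r}"
  by (auto simp: lev_def)

lemma lev_unique: "v \<in> lev r i \<Longrightarrow> v \<in> lev r j \<Longrightarrow> i = j"
  unfolding lev_def by (metis (mono_tags, lifting) linorder_neqE_nat mem_Collect_eq)

lemma lev_Suc_disjoint: "v \<in> lev r k \<Longrightarrow> v \<notin> lev r (Suc k)"
  using lev_unique[of v r k "Suc k"] by auto

lemma lev_exists:
  assumes "(r, v) \<in> {(x, y). E x y} ^^ n"
  shows "\<exists>k\<le>n. v \<in> lev r k"
proof -
  define k where "k = (LEAST n. (r, v) \<in> {(x, y). E x y} ^^ n)"
  have "(r, v) \<in> {(x, y). E x y} ^^ k" using assms unfolding k_def by (rule LeastI)
  moreover have "k \<le> n" using assms unfolding k_def by (rule Least_le)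
  moreover have "\<forall>j<k. (r, v) \<notin> {(x, y). E x y} ^^ j"
    unfolding k_def using not_less_Least by blast
  ultimately show ?thesis unfolding lev_def by blast
qed

lemma lev_parent:
  assumes "v \<in> lev r (Suc k)"
  shows "\<exists>p\<in>lev r k. E p v"
proof -
  obtain p where p: "(r, p) \<in> {(x, y). E x y} ^^ k" "E p v"
    using assms unfolding lev_def by auto
  obtain j where j: "j \<le> k" "p \<in> lev r j" using lev_exists[OF p(1)] by blast
  have "(r, v) \<in> {(x, y). E x y} ^^ Suc j" using j(2) p(2) unfolding lev_def by auto
  then have "\<not> Suc j < Suc k" using assms unfolding lev_def by blast
  then show ?thesis using j p by (metis antisym_conv2 Suc_less_eq)
qed

lemma lev_edge:
  assumes "u \<in> lev r i" "v \<in> lev r j" "E u v"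
  shows "j \<le> Suc i"
proof -
  have "(r, v) \<in> {(x, y). E x y} ^^ Suc i" using assms(1,3) unfolding lev_def by auto
  then show ?thesis using lev_exists lev_unique assms(2) by blast
qed

lemma below_not_adj: "u \<in> below r k \<Longrightarrow> v \<in> lev r j \<Longrightarrow> k < j \<Longrightarrow> \<not> E u v \<and> \<not> E v u"
  unfolding below_def using lev_edge sym by fastforce

lemma below_disjoint: "u \<in> below r k \<Longrightarrow> u \<in> lev r j \<Longrightarrow> k \<le> j \<Longrightarrow> False"
  unfolding below_def using lev_unique by fastforce

text \<open>Both vertices reach \<open>r\<close> by descending through parents. The walk via
  \<open>r\<close> meets level \<open>k\<close> only in \<open>p\<close> and \<open>p'\<close>, and
  \<open>ipath_exists\<close> turns it into an induced path on the same set.\<close>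

lemma lev_path:
  assumes "p \<in> lev r k" "p' \<in> lev r k"
  obtains R where "ipath R" "R \<noteq> []" "hd R = p" "last R = p'" "set R \<subseteq> {p, p'} \<union> below r k"
proof -
  define U where "U = {p, p'} \<union> below r k"
  define e where "e = {(x, y). E x y \<and> x \<in> U \<and> y \<in> U}"
  have "sym e" unfolding e_def by (auto intro!: symI sym)
  then have syme: "(y, x) \<in> e\<^sup>*" if "(x, y) \<in> e\<^sup>*" for x y
    using that sym_rtrancl symD by metis
  have *: "(r, v) \<in> e\<^sup>*" if "v \<in> lev r j" "v \<in> U" "j \<le> k" for v j
    using that
  proof (induction j arbitrary: v)
    case (Suc j)
    obtain q where q: "q \<in> lev r j" "E q v" using lev_parent Suc.prems by blast
    have "q \<in> U" unfolding U_def below_def using q Suc.prems by auto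
    then have "(r, q) \<in> e\<^sup>*" "(q, v) \<in> e" using Suc q unfolding e_def by auto
    then show ?case by auto
  qed simp
  have "(p, r) \<in> e\<^sup>*" "(r, p') \<in> e\<^sup>*"
    using *[of p k] *[of p' k] assms syme unfolding U_def by auto
  then have "(p, p') \<in> e\<^sup>*" by (rule rtrancl_trans)
  then show ?thesis using ipath_exists[of p p' U] that unfolding e_def U_def by blast
qed

lemma colorable_from_levels:
  assumes "\<And>r k. colorable (lev r k) n"
  shows "colorable UNIV (2 * n)"
proof -
  define e where "e = {(x, y). E x y}"
  have "sym e" unfolding e_def by (auto intro!: symI sym)
  then have syme: "(y, x) \<in> e\<^sup>*" if "(x, y) \<in> e\<^sup>*" for x y
    using that sym_rtrancl symD by metis
  \<comment> \<open>A root for the component of \<open>v\<close>: the set of vertices reachable from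
    \<open>v\<close> is the same throughout the component, so the choice is too.\<close>
  define rep where "rep v = (SOME u. (v, u) \<in> e\<^sup>*)" for v
  have rep: "(rep v, v) \<in> e\<^sup>*" for v
    unfolding rep_def by (rule syme, rule someI[of _ v]) simp
  have rep_eq: "rep u = rep v" if "E u v" for u v
  proof -
    have "(u, v) \<in> e" "(v, u) \<in> e" using that sym unfolding e_def by auto
    then have "(u, w) \<in> e\<^sup>* \<longleftrightarrow> (v, w) \<in> e\<^sup>*" for w
      by (meson converse_rtrancl_into_rtrancl)
    then show ?thesis unfolding rep_def by simp
  qed
  have "\<exists>k. v \<in> lev (rep v) k" for v
    using rep[of v] lev_exists unfolding e_def rtrancl_power by blast
  then obtain l where l: "\<And>v. v \<in> lev (rep v) (l v)" by metis
  obtain c where c: "\<And>r k v. v \<in> lev r k \<Longrightarrow> c r k v < n"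
     "\<And>r k u v. u \<in> lev r k \<Longrightarrow> v \<in> lev r k \<Longrightarrow> E u v \<Longrightarrow> c r k u \<noteq> (c r k v :: nat)"
    using assms unfolding colorable_def by metis
  \<comment> \<open>This encodes the colour within the level and the parity of the level as one
    number below \<open>2 * n\<close>. Adjacent vertices lie in equal or consecutive levels, so
    equal parity puts them in the same level.\<close>
  define d where "d v = 2 * c (rep v) (l v) v + l v mod 2" for v
  have "d v < 2 * n" for v
    using c(1)[OF l[of v]] unfolding d_def by linarith
  moreover have "d u \<noteq> d v" if "E u v" for u v
  proof
    assume eq: "d u = d v"
    then have "l u mod 2 = l v mod 2" "c (rep u) (l u) u = c (rep v) (l v) v"
      unfolding d_def by presburger+
    moreover have "l u \<le> Suc (l v)" "l v \<le> Suc (l u)"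
      using lev_edge l rep_eq that sym by metis+
    then have "l u = l v \<or> l u = Suc (l v) \<or> l v = Suc (l u)" by linarith
    ultimately have "l u = l v" by (auto simp: mod_Suc split: if_splits)
    then show False using c(2)[of u "rep u" "l u" v] l[of u] l[of v] rep_eq[OF that] that
       \<open>c (rep u) (l u) u = c (rep v) (l v) v\<close> by auto
  qed
  ultimately show ?thesis unfolding colorable_def by blast
qed

text \<open>The interior of \<open>R\<close> lies at least two levels below \<open>Q\<close>, so
  only the ends of \<open>R\<close> see \<open>Q\<close>.\<close>

lemma icyc_below:
  assumes "ipath Q" "set Q \<subseteq> lev r (Suc k)" "2 \<le> length Q"
    and "ipath R" "R \<noteq> []" "hd R \<noteq> last R" "hd R \<in> lev r k" "last R \<in> lev r k"
    and "set R \<subseteq> {hd R, last R} \<union> below r k"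
    and "\<And>x. x \<in> set Q \<Longrightarrow> E (hd R) x \<longleftrightarrow> x = hd Q"
    and "\<And>x. x \<in> set Q \<Longrightarrow> E (last R) x \<longleftrightarrow> x = last Q"
  shows "icyc (Q @ rev R)"
proof (rule icyc_join)
  have "length R \<noteq> 1" using assms(6) by (cases R) auto
  moreover have "length R \<noteq> 0" using assms(5) by simp
  ultimately show "4 \<le> length Q + length R" using assms(3) by linarith
  have dj: "y \<notin> set Q" if yR: "y \<in> set R" for y
  proof
    assume "y \<in> set Q"
    then have y: "y \<in> lev r (Suc k)" using assms(2) by blast
    consider "y = hd R" | "y = last R" | "y \<in> below r k" using yR assms(9) by blast
    then show False
      using y lev_unique[of y r "Suc k" k] below_disjoint[of y r k "Suc k"] assms(7,8)
      by cases auto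
  qed
  then show "set Q \<inter> set R = {}" by blast
  show "E x y \<longleftrightarrow> x = hd Q \<and> y = hd R \<or> x = last Q \<and> y = last R"
    if x: "x \<in> set Q" and y: "y \<in> set R" for x y
  proof -
    consider "y = hd R" | "y = last R" | "y \<in> below r k" using y assms(9) by blast
    then show ?thesis
    proof cases
      case 1
      then show ?thesis using assms(6) assms(10)[OF x] sym_iff by metis
    next
      case 2
      then show ?thesis using assms(6) assms(11)[OF x] sym_iff by metis
    next
      case 3
      have "y \<noteq> hd R" "y \<noteq> last R" using 3 below_disjoint assms(7,8) by blast+
      then show ?thesis using below_not_adj[OF 3, of x "Suc k"] x assms(2) by blast
    qed
  qed
qed (use assms in auto)

end

section \<open>Girth at least 5 and no long odd hole: bounds for paths below a level\<close>

section \<open>Holes through parents\<close>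

text \<open>The relation lives on the whole type, so finiteness is asked of the vertices that have
  an edge. In the form chosen, \<open>no_square\<close> says that two distinct vertices have at most
  one common neighbour.\<close>

locale long_odd_hole_free = symmetric_relation +
  assumes no_triangle: "E x y \<Longrightarrow> E y z \<Longrightarrow> \<not> E z x"
    and no_square: "E a b \<Longrightarrow> E b c \<Longrightarrow> E c d \<Longrightarrow> E d a \<Longrightarrow> a \<noteq> c \<Longrightarrow> b = d"
    and no_long_odd_hole: "icyc cs \<Longrightarrow> odd (length cs) \<Longrightarrow> length cs < 9"
    and finite_edges: "finite {x. \<exists>y. E x y}"
begin

lemma common_nbr: "E b x \<Longrightarrow> E b y \<Longrightarrow> E z x \<Longrightarrow> E z y \<Longrightarrow> x \<noteq> y \<Longrightarrow> b = z"
  using no_square[of x b y z] sym by blast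

lemma finite_lev: "finite (lev r k)"
proof -
  have "lev r k \<subseteq> insert r {x. \<exists>y. E x y}"
  proof (cases k)
    case (Suc j)
    then show ?thesis using lev_parent sym by blast
  qed simp
  then show ?thesis using finite_edges finite_subset by blast
qed

text \<open>By \<open>icyc_below\<close> the two paths close up to a hole, and an odd length below 9
  is at most 7.\<close>

lemma hole_below_bound:
  assumes Q: "ipath Q" "set Q \<subseteq> lev r (Suc k)" "2 \<le> length Q"
    and R: "ipath R" "R \<noteq> []" "hd R = p" "last R = p'" "set R \<subseteq> {p, p'} \<union> below r k"
    and p: "p \<in> lev r k" "p' \<in> lev r k" "p \<noteq> p'"
    and e: "\<And>x. x \<in> set Q \<Longrightarrow> E p x \<longleftrightarrow> x = hd Q" "\<And>x. x \<in> set Q \<Longrightarrow> E p' x \<longleftrightarrow> x = last Q"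
    and o: "odd (length Q + length R)"
  shows "length Q + length R \<le> 7"
proof -
  have "icyc (Q @ rev R)"
    by (rule icyc_below[OF Q R(1,2)]) (use R p e in simp_all)
  then have "length Q + length R < 9"
    using o no_long_odd_hole[of "Q @ rev R"] by simp
  moreover have "length Q + length R \<noteq> 8" using o by (metis even_numeral)
  ultimately show ?thesis by simp
qed

lemma ipath_length_ge_3:
  assumes "ipath R" "R \<noteq> []" "hd R \<noteq> last R" "\<not> E (hd R) (last R)"
  shows "3 \<le> length R"
proof (rule ccontr)
  assume "\<not> ?thesis"
  then have "length R = 0 \<or> length R = 1 \<or> length R = 2" by linarith
  then show False using assms by (auto simp: length_Suc_conv numeral_2_eq_2)
qed

text \<open>The parents \<open>q\<close> and \<open>q'\<close> are distinct and nonadjacent, so an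
  induced path between them has at least three vertices. Adding \<open>p\<close> and
  \<open>p'\<close> gives five, and the non-adjacencies in \<open>n\<close> keep the longer path
  induced.\<close>

lemma ipath_extend_below:
  assumes p: "p \<in> lev r (Suc k)" "p' \<in> lev r (Suc k)" "p \<noteq> p'" "\<not> E p p'"
    and q: "q \<in> lev r k" "q' \<in> lev r k" "E q p" "E q' p'"
    and n: "\<not> E q p'" "\<not> E q' p" "\<not> E q q'"
  shows "\<exists>R. ipath R \<and> R \<noteq> [] \<and> hd R = p \<and> last R = p' \<and> 5 \<le> length R \<and>
    set R \<subseteq> {p, p'} \<union> below r (Suc k)"
proof -
  have qq: "q \<noteq> q'" using q n by blast
  obtain R where R: "ipath R" "R \<noteq> []" "hd R = q" "last R = q'" "set R \<subseteq> {q, q'} \<union> below r k"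
    using lev_path[OF q(1,2)] by blast
  have "3 \<le> length R" using ipath_length_ge_3[of R] R qq n by simp
  have sub: "set R \<subseteq> below r (Suc k)"
    using R(5) q unfolding below_def by (fastforce simp: less_Suc_eq)
  then have pn: "p \<notin> set R" "p' \<notin> set R" using below_disjoint[of _ r "Suc k" "Suc k"] p by blast+
  have e: "E x p \<longleftrightarrow> x = q" "E x p' \<longleftrightarrow> x = q'" if xR: "x \<in> set R" for x
  proof -
    consider "x = q" | "x = q'" | "x \<in> below r k" "x \<noteq> q" "x \<noteq> q'" using xR R(5) by blast
    then show "E x p \<longleftrightarrow> x = q" "E x p' \<longleftrightarrow> x = q'"
      using q n qq below_not_adj[of x r k _ "Suc k"] p by (cases; blast)+
  qed
  have "ipath (R @ [p'])" using R e pn by (subst ipath_append) auto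
  moreover have "E p y \<longleftrightarrow> y = q" if "y \<in> set (R @ [p'])" for y
    using that e(1)[of y] sym_iff[of p y] p(4) pn(2) R(2,3) hd_in_set by fastforce
  moreover have "hd (R @ [p']) = q" using R(2,3) by simp
  ultimately have "ipath (p # R @ [p'])" using pn(1) p(3) by simp
  then show ?thesis using \<open>3 \<le> length R\<close> sub by (intro exI[of _ "p # R @ [p']"]) auto
qed

text \<open>A chord, or a coincidence of two nonconsecutive vertices, would produce a
  triangle.\<close>

lemma closed_5_walk:
  assumes "E a b" "E b c" "E c d" "E d e" "E e a"
  shows "icyc [a, b, c, d, e]"
proof -
  have "\<not> E a c" "\<not> E a d" "\<not> E b d" "\<not> E b e" "\<not> E c e"
    using assms no_triangle sym by blast+
  moreover have "a \<noteq> b" "a \<noteq> c" "a \<noteq> d" "a \<noteq> e" "b \<noteq> c" "b \<noteq> d" "b \<noteq> e" "c \<noteq> d" "c \<noteq> e" "d \<noteq> e"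
    using assms no_triangle irrefl sym by blast+
  ultimately show ?thesis using assms sym by (auto simp: icyc_def)
qed

lemma heptagon_adj:
  assumes "icyc [c0, c1, c2, c3, c4, c5, c6]"
  shows "E c0 c1" "E c1 c2" "E c2 c3" "E c3 c4" "E c4 c5" "E c5 c6" "E c6 c0"
  using assms by (auto simp: icyc_def intro: sym)

lemma heptagon_rotate:
  assumes "icyc [c0, c1, c2, c3, c4, c5, c6]"
  shows "icyc [c1, c2, c3, c4, c5, c6, c0]"
  using icyc_rotate[OF assms] by simp

section \<open>Pendant paths on an odd hole and the parents of their ends\<close>

section \<open>Tails attached to an odd hole\<close>

text \<open>A tail hanging off \<open>C\<close> at \<open>b\<close>, whose only contact with
  \<open>C\<close> is the edge at \<open>b\<close>. The list leaves out \<open>b\<close>, so that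
  the empty tail is allowed.\<close>

definition attached :: "'a set \<Rightarrow> 'a \<Rightarrow> 'a list \<Rightarrow> bool" where
  "attached C b xs \<longleftrightarrow> b \<in> C \<and> ipath (b # xs) \<and> set xs \<inter> C = {} \<and>
     (\<forall>x\<in>set xs. \<forall>c\<in>C. E x c \<longleftrightarrow> x = hd xs \<and> c = b)"

lemma attached_Nil [simp]: "attached C b [] \<longleftrightarrow> b \<in> C"
  by (auto simp: attached_def)

lemma attached_appendD:
  assumes "attached C b (us @ vs)"
  shows "attached C b us"
proof (cases "us = []")
  case False
  have "ipath (b # us)" using ipath_appendD[of "b # us" vs] assms unfolding attached_def by simp
  then show ?thesis using assms False unfolding attached_def by auto
qed (use assms in \<open>simp add: attached_def\<close>)

lemma attached_mono: "attached C b xs \<Longrightarrow> D \<subseteq> C \<Longrightarrow> b \<in> D \<Longrightarrow> attached D b xs"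
  unfolding attached_def by blast

lemma attached_snoc:
  assumes a: "attached C b xs" and w: "w \<notin> C \<union> set xs"
    and e: "\<And>s. s \<in> C \<union> set xs \<Longrightarrow> E w s \<longleftrightarrow> s = last (b # xs)"
  shows "attached C b (xs @ [w])"
proof -
  have b: "b \<in> C" "ipath (b # xs)" "set xs \<inter> C = {}" using a unfolding attached_def by auto
  have "E x w \<longleftrightarrow> x = last (b # xs)" if "x \<in> set (b # xs)" for x
    using e[of x] that b(1) sym_iff[of w x] by auto
  moreover have "set (b # xs) \<inter> set [w] = {}" using w b(1) by auto
  ultimately have "ipath ((b # xs) @ [w])" using b(2) by (subst ipath_append) simp_all
  moreover have "E x c \<longleftrightarrow> x = hd (xs @ [w]) \<and> c = b" if "x \<in> set (xs @ [w])" "c \<in> C" for x c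
  proof (cases "x = w")
    case True
    show ?thesis
    proof (cases "xs = []")
      case False
      then have "last (b # xs) \<in> set xs" "hd (xs @ [w]) \<in> set xs" by auto
      then show ?thesis using True e[of c] that(2) b(3) w by auto
    qed (use True e[of c] that(2) in auto)
  next
    case False
    then have "x \<in> set xs" "hd (xs @ [w]) = hd xs" using that(1) by (auto simp: hd_append)
    then show ?thesis using a that(2) unfolding attached_def by simp
  qed
  ultimately show ?thesis using b w unfolding attached_def by auto
qed

lemma attached_path:
  assumes x: "attached C b xs" and y: "attached C a ys"
    and xy: "set xs \<inter> set ys = {}" "\<And>x y. x \<in> set xs \<Longrightarrow> y \<in> set ys \<Longrightarrow> \<not> E x y"
    and A: "ipath A" "A \<noteq> []" "set A \<subseteq> C" "hd A = b" "last A = a"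
  shows "ipath (rev xs @ A @ ys)"
proof -
  have X: "ipath (b # xs)" "set xs \<inter> C = {}" "\<And>x c. x \<in> set xs \<Longrightarrow> c \<in> C \<Longrightarrow> E x c \<longleftrightarrow> x = hd xs \<and> c = b"
    using x unfolding attached_def by auto
  have Y: "ipath (a # ys)" "set ys \<inter> C = {}" "\<And>x c. x \<in> set ys \<Longrightarrow> c \<in> C \<Longrightarrow> E x c \<longleftrightarrow> x = hd ys \<and> c = a"
    using y unfolding attached_def by auto
  have Ay: "ipath (A @ ys)"
  proof (cases "ys = []")
    case False
    have "E u v \<longleftrightarrow> u = last A \<and> v = hd ys" if "u \<in> set A" "v \<in> set ys" for u v
      using Y(3)[of v u] that A(3,5) sym_iff[of u v] by blast
    then show ?thesis using A Y False by (subst ipath_append) auto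
  qed (use A in simp)
  show ?thesis
  proof (cases "xs = []")
    case False
    have "E u v \<longleftrightarrow> u = last (rev xs) \<and> v = hd (A @ ys)" if "u \<in> set xs" "v \<in> set (A @ ys)" for u v
    proof (cases "v \<in> set A")
      case True
      then show ?thesis using X(3)[of u v] that A False by (auto simp: last_rev)
    next
      case False
      then have "v \<in> set ys" "v \<noteq> b" using that(2) A hd_in_set[OF A(2)] by auto
      then show ?thesis using xy(2)[of u v] that(1) A by auto
    qed
    moreover have "set (rev xs) \<inter> set (A @ ys) = {}" using X(2) xy(1) A(3) by auto
    moreover have "ipath (rev xs)" using X(1) by simp
    ultimately show ?thesis using Ay False A(2) by (subst ipath_append) auto
  qed (use Ay in simp)
qed

text \<open>The free parameter \<open>P\<close> selects one of the two arcs between \<open>s\<close>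
  and \<open>b\<close>, whose parities differ on an odd hole.\<close>

lemma icyc_route_parity:
  assumes "icyc cs" "odd (length cs)" "s \<in> set cs" "b \<in> set cs" "s \<noteq> b" "\<not> E s b"
  obtains A where "ipath A" "A \<noteq> []" "hd A = s" "last A = b" "3 \<le> length A" "set A \<subseteq> set cs"
    "even (length A) \<longleftrightarrow> P"
proof -
  obtain A B where AB: "ipath A" "ipath B" "A \<noteq> []" "B \<noteq> []" "hd A = s" "hd B = s"
     "last A = b" "last B = b" "3 \<le> length A" "3 \<le> length B"
     "set A \<subseteq> set cs" "set B \<subseteq> set cs" "length A + length B = length cs + 2"
    using icyc_two_paths[OF assms(1,3,4,5,6)] by blast
  have "odd (length A + length B)" unfolding AB(13) using assms(2) by simp
  then have "even (length A) \<longleftrightarrow> odd (length B)" by simp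
  show ?thesis
  proof (cases "even (length A) \<longleftrightarrow> P")
    case True
    show ?thesis by (rule that[OF AB(1,3,5,7,9,11) True])
  next
    case False
    then have "even (length B) \<longleftrightarrow> P" using \<open>even (length A) \<longleftrightarrow> odd (length B)\<close> by blast
    then show ?thesis by (rule that[OF AB(2,4,6,8,10,12)])
  qed
qed

text \<open>
  Two routes round the odd cycle have different parities, so all neighbours of \<open>p\<close>
  close to the cycle, other than \<open>b\<close>, would close up a long odd hole.
\<close>

lemma tail_end_nbrs:
  assumes C: "icyc cs" "odd (length cs)" "a \<in> set cs" "a \<noteq> b" "\<not> E b a"
    and x: "attached (set cs) b xs" "length xs = 8" and y: "attached (set cs) a ys"
    and xy: "set xs \<inter> set ys = {}" "\<And>x y. x \<in> set xs \<Longrightarrow> y \<in> set ys \<Longrightarrow> \<not> E x y"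
    and p: "p \<notin> set cs \<union> set xs \<union> set ys" "E p (last xs)"
    and uniq: "\<And>s t. s \<in> set cs \<union> set (butlast xs) \<union> set ys \<Longrightarrow>
        t \<in> set cs \<union> set (butlast xs) \<union> set ys \<Longrightarrow> E p s \<Longrightarrow> E p t \<Longrightarrow> s = t"
  shows "\<And>s. s \<in> set cs \<union> set ys \<Longrightarrow> E p s \<Longrightarrow> s = b" "\<not> E p (hd xs)"
proof -
  have b: "b \<in> set cs" using x(1) unfolding attached_def by blast
  have ne: "xs \<noteq> []" using x(2) by auto
  have sx: "set xs = insert (last xs) (set (butlast xs))"
    using arg_cong[OF append_butlast_last_id[OF ne], of set] by auto
  \<comment> \<open>\<open>Q\<close> leads from the end of the tail to a second neighbour
    \<open>s\<close> of \<open>p\<close>, and \<open>uniq\<close> excludes further neighbours on it.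
    Having an even number of vertices and at least 8 of them, it closes with \<open>p\<close> to an
    odd hole of length at least 9.\<close>
  have core: False
    if "ipath Q" "Q \<noteq> []" "hd Q = last xs" "last Q = s" "set Q \<subseteq> set cs \<union> set xs \<union> set ys" "even (length Q)"
      "8 \<le> length Q" "E p s" "s \<in> set cs \<union> set (butlast xs) \<union> set ys" for Q s
  proof -
    have "E p x \<longleftrightarrow> x = hd Q \<or> x = last Q" if "x \<in> set Q" for x
    proof
      assume "E p x"
      have "x = last xs \<or> x \<in> set cs \<union> set (butlast xs) \<union> set ys"
        using that \<open>set Q \<subseteq> _\<close> sx by blast
      then show "x = hd Q \<or> x = last Q"
        using uniq[OF _ \<open>s \<in> _\<close> \<open>E p x\<close> \<open>E p s\<close>] \<open>hd Q = _\<close> \<open>last Q = _\<close> by auto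
    qed (use \<open>hd Q = _\<close> \<open>last Q = _\<close> \<open>E p s\<close> p(2) in auto)
    moreover have "p \<notin> set Q" using p(1) \<open>set Q \<subseteq> _\<close> by blast
    ultimately have "icyc (p # Q)" using that(1,7) by (intro icyc_snoc) auto
    then show False using no_long_odd_hole[of "p # Q"] that(6,7) by auto
  qed
  have hx: "hd (rev xs @ zs) = last xs" for zs using ne by (simp add: hd_rev)
  have sub: "set (butlast xs) \<subseteq> set xs" using sx by blast
  \<comment> \<open>The tail alone, with its 8 vertices, would be such a path.\<close>
  show "\<not> E p (hd xs)"
  proof
    assume "E p (hd xs)"
    moreover have "hd xs \<in> set (butlast xs)"
      using x(2) by (cases xs; cases "tl xs") auto
    moreover have "ipath (rev xs)" using x(1) unfolding attached_def by simp
    ultimately show False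
      using core[of "rev xs" "hd xs"] hx[of "[]"] ne x(2) by (auto simp: last_rev)
  qed
  show "s = b" if s: "s \<in> set cs \<union> set ys" "E p s" for s
  proof (rule ccontr)
    assume sb: "s \<noteq> b"
    show False
    proof (cases "s \<in> set ys")
      case True
      then obtain us vs where ys: "ys = us @ s # vs" by (meson split_list)
      have ys': "attached (set cs) a (us @ [s])" using attached_appendD[of _ a "us @ [s]" vs] y ys by simp
      \<comment> \<open>The parity of the arc compensates for the number of vertices of
        \<open>ys\<close> up to \<open>s\<close>.\<close>
      obtain A where A: "ipath A" "A \<noteq> []" "hd A = b" "last A = a" "3 \<le> length A" "set A \<subseteq> set cs"
        "even (length A) \<longleftrightarrow> odd (length us)"
        by (rule icyc_route_parity[OF C(1,2) b C(3) C(4)[symmetric] C(5), where P = "odd (length us)"])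
      let ?Q = "rev xs @ A @ (us @ [s])"
      have "ipath ?Q"
        using xy unfolding ys by (intro attached_path[OF x(1) ys' _ _ A(1,2,6,3,4)]) auto
      moreover have "set ?Q \<subseteq> set cs \<union> set xs \<union> set ys" using A(6) ys by auto
      moreover have "even (length ?Q)" "8 \<le> length ?Q" using A(7) x(2) by auto
      ultimately show False using core[of ?Q s] hx s True by simp
    next
      case False
      then have sC: "s \<in> set cs" using s by blast
      obtain A where A: "ipath A" "A \<noteq> []" "hd A = b" "last A = s" "set A \<subseteq> set cs" "even (length A)"
      proof (cases "E b s")
        case True
        then have "ipath [b, s]" using sb by auto
        then show ?thesis using that[of "[b, s]"] b sC by simp
      next
        case False
        show ?thesis
          by (rule icyc_route_parity[OF C(1,2) b sC sb[symmetric] False, where P = True])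
             (use that in simp)
      qed
      let ?Q = "rev xs @ A @ []"
      have "ipath ?Q" using sC by (intro attached_path[OF x(1) _ _ _ A(1,2,5,3,4)]) auto
      moreover have "set ?Q \<subseteq> set cs \<union> set xs \<union> set ys" using A(5) by auto
      moreover have "even (length ?Q)" "8 \<le> length ?Q" using A(6) x(2) by auto
      moreover have "last ?Q = s" using A(2,4) by simp
      moreover have "?Q \<noteq> []" using A(2) by simp
      ultimately show False using core[OF _ _ hx _ _ _ _ s(2)] sC by blast
    qed
  qed
qed

text \<open>\<open>us\<close> is the piece of the tail up to the first neighbour of
  \<open>p\<close>, empty if \<open>b\<close> itself is one. Length 1 is impossible because
  \<open>p\<close> is not adjacent to the first vertex of the tail; together with a length bound
  this will force \<open>us\<close> to be empty.\<close>

lemma first_nbr_prefix: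
  assumes "xs \<noteq> []" "E p (last xs)" "\<not> E p (hd xs)"
  obtains us vs where "xs = us @ vs" "length us \<noteq> 1"
    "\<And>x. x \<in> set (b # us) \<Longrightarrow> E p x \<longleftrightarrow> x = last (b # us)"
proof -
  have "\<exists>x\<in>set (b # xs). E p x" using assms(1,2) by auto
  then obtain us0 s vs where s: "b # xs = us0 @ s # vs" "E p s" "\<forall>x\<in>set us0. \<not> E p x"
    using split_list_first_prop[of "b # xs" "E p"] by blast
  show ?thesis
  proof (cases us0)
    case Nil
    then show ?thesis using that[of "[]" xs] s by simp
  next
    case (Cons c us1)
    then have "xs = (us1 @ [s]) @ vs" "c = b" using s(1) by auto
    moreover from this have "us1 \<noteq> []" using assms(3) s(2) by auto
    ultimately show ?thesis using that[of "us1 @ [s]" vs] s(2,3) Cons by auto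
  qed
qed

text \<open>Cut the tails at the first neighbours of \<open>p\<close> and \<open>p'\<close>. The
  remaining pieces, an arc of suitable parity and a path \<open>R\<close> below form an odd hole. It
  has at most 7 vertices and the arc at least 3, so the pieces and \<open>R\<close> have at most 4
  together. As \<open>R\<close> has at least 3 and no piece has length 1, both pieces are empty, and
  the first neighbours are \<open>b\<close> and \<open>a\<close>.\<close>

lemma tail_ends_at_cycle:
  assumes C: "icyc cs" "odd (length cs)" "a \<noteq> b" "\<not> E b a"
    and x: "attached (set cs) b xs" "length xs = 8" and y: "attached (set cs) a ys" "length ys = 8"
    and xy: "set xs \<inter> set ys = {}" "\<And>x y. x \<in> set xs \<Longrightarrow> y \<in> set ys \<Longrightarrow> \<not> E x y"
    and l: "set cs \<union> set xs \<union> set ys \<subseteq> lev r (Suc k)"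
    and p: "p \<in> lev r k" "E p (last xs)" "\<not> E p (last ys)"
    and p': "p' \<in> lev r k" "E p' (last ys)"
    and uniq: "\<And>s t. s \<in> set cs \<union> set (butlast xs) \<union> set (butlast ys) \<Longrightarrow>
        t \<in> set cs \<union> set (butlast xs) \<union> set (butlast ys) \<Longrightarrow> E p s \<Longrightarrow> E p t \<Longrightarrow> s = t"
    and uniq': "\<And>s t. s \<in> insert p (set cs \<union> set xs \<union> set (butlast ys)) \<Longrightarrow>
        t \<in> insert p (set cs \<union> set xs \<union> set (butlast ys)) \<Longrightarrow> E p' s \<Longrightarrow> E p' t \<Longrightarrow> s = t"
  shows "E p b \<and> E p' a \<and> \<not> E p p' \<and>
    (\<forall>R. ipath R \<and> R \<noteq> [] \<and> hd R = p \<and> last R = p' \<and> set R \<subseteq> {p, p'} \<union> below r k \<longrightarrow> length R \<le> 4)"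
proof -
  have ab: "a \<in> set cs" "b \<in> set cs" using x(1) y(1) unfolding attached_def by blast+
  have ne: "xs \<noteq> []" "ys \<noteq> []" using x(2) y(2) by auto
  have sx: "set xs = insert (last xs) (set (butlast xs))"
    using arg_cong[OF append_butlast_last_id[OF ne(1)], of set] by auto
  have sy: "set ys = insert (last ys) (set (butlast ys))"
    using arg_cong[OF append_butlast_last_id[OF ne(2)], of set] by auto
  have pp: "p \<noteq> p'" using p p' by blast
  have out: "p \<notin> set cs \<union> set xs \<union> set ys" "p' \<notin> set cs \<union> set ys \<union> set xs"
    using lev_Suc_disjoint[OF p(1)] lev_Suc_disjoint[OF p'(1)] l by blast+
  have P: "\<And>s. s \<in> set cs \<union> set ys \<Longrightarrow> E p s \<Longrightarrow> s = b" "\<not> E p (hd xs)"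
  proof -
    have u: "s = t" if "s \<in> set cs \<union> set (butlast xs) \<union> set ys" "t \<in> set cs \<union> set (butlast xs) \<union> set ys"
      "E p s" "E p t" for s t
    proof (rule uniq)
      show "s \<in> set cs \<union> set (butlast xs) \<union> set (butlast ys)"
        "t \<in> set cs \<union> set (butlast xs) \<union> set (butlast ys)"
        using that p(3) sy by auto
    qed fact+
    show "\<And>s. s \<in> set cs \<union> set ys \<Longrightarrow> E p s \<Longrightarrow> s = b" "\<not> E p (hd xs)"
      using tail_end_nbrs[OF C(1,2) ab(1) C(3,4) x y(1) xy out(1) p(2) u] by blast+
  qed
  have P': "\<And>s. s \<in> set cs \<union> set xs \<Longrightarrow> E p' s \<Longrightarrow> s = a" "\<not> E p' (hd ys)"
  proof -
    have u: "s = t" if "s \<in> set cs \<union> set (butlast ys) \<union> set xs" "t \<in> set cs \<union> set (butlast ys) \<union> set xs"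
      "E p' s" "E p' t" for s t
      using uniq'[of s t] that by blast
    have yx: "set ys \<inter> set xs = {}" "\<And>y x. y \<in> set ys \<Longrightarrow> x \<in> set xs \<Longrightarrow> \<not> E y x"
      using xy sym by blast+
    have na: "\<not> E a b" using C(4) sym by blast
    show "\<And>s. s \<in> set cs \<union> set xs \<Longrightarrow> E p' s \<Longrightarrow> s = a" "\<not> E p' (hd ys)"
      using tail_end_nbrs[OF C(1,2) ab(2) C(3)[symmetric] na y x(1) yx out(2) p'(2) u] by blast+
  qed
  obtain us vs where us: "xs = us @ vs" "length us \<noteq> 1"
    "\<And>x. x \<in> set (b # us) \<Longrightarrow> E p x \<longleftrightarrow> x = last (b # us)"
    using first_nbr_prefix[OF ne(1) p(2) P(2), of b] by blast
  obtain us' vs' where us': "ys = us' @ vs'" "length us' \<noteq> 1"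
    "\<And>x. x \<in> set (a # us') \<Longrightarrow> E p' x \<longleftrightarrow> x = last (a # us')"
    using first_nbr_prefix[OF ne(2) p'(2) P'(2), of a] by blast
  have ax: "attached (set cs) b us" "attached (set cs) a us'"
    using attached_appendD x(1) y(1) us(1) us'(1) by blast+
  have dj: "set xs \<inter> set cs = {}" "set ys \<inter> set cs = {}" using x(1) y(1) unfolding attached_def by blast+
  have short: "length us + length us' + length R \<le> 4"
    if R: "ipath R" "R \<noteq> []" "hd R = p" "last R = p'" "set R \<subseteq> {p, p'} \<union> below r k" for R
  proof -
    obtain A where A: "ipath A" "A \<noteq> []" "hd A = b" "last A = a" "3 \<le> length A" "set A \<subseteq> set cs"
      "even (length A) \<longleftrightarrow> odd (length us + length us' + length R)"
      by (rule icyc_route_parity[OF C(1,2) ab(2,1) C(3)[symmetric] C(4),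
            where P = "odd (length us + length us' + length R)"])
    let ?Q = "rev us @ A @ us'"
    have Q: "ipath ?Q"
      using xy unfolding us(1) us'(1) by (intro attached_path[OF ax _ _ A(1,2,6,3,4)]) auto
    have hQ: "hd ?Q = last (b # us)" using A(2,3) by (cases "us = []") (auto simp: hd_rev)
    have lQ: "last ?Q = last (a # us')" using A(2,4) by simp
    have Qs: "set ?Q \<subseteq> set cs \<union> set us \<union> set us'" using A(6) by auto
    have sub: "set us \<subseteq> set xs" "set us' \<subseteq> set ys" using us(1) us'(1) by auto
    have lb: "last (b # us) \<in> set cs \<union> set us" "last (a # us') \<in> set cs \<union> set us'"
      using ab by (auto simp: last_in_set)
    have "E p x \<longleftrightarrow> x = hd ?Q" if x: "x \<in> set ?Q" for x
    proof -
      consider "x \<in> set (b # us)" | "x \<in> set cs" "x \<noteq> b" | "x \<in> set us'" using x Qs by auto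
      then show ?thesis
      proof cases
        case 1
        then show ?thesis using us(3) hQ by simp
      next
        case 2
        then have "\<not> E p x" "x \<notin> set us" using P(1) sub dj by blast+
        then show ?thesis using 2 hQ by auto
      next
        case 3
        then have "x \<in> set ys" "x \<notin> set cs" "x \<notin> set us" using sub dj xy by blast+
        then have "\<not> E p x" "x \<notin> set (b # us)" using P(1)[of x] ab by auto
        then show ?thesis unfolding hQ using last_in_set[of "b # us"] by auto
      qed
    qed
    moreover have "E p' x \<longleftrightarrow> x = last ?Q" if x: "x \<in> set ?Q" for x
    proof -
      consider "x \<in> set (a # us')" | "x \<in> set cs" "x \<noteq> a" | "x \<in> set us" using x Qs by auto
      then show ?thesis
      proof cases
        case 1
        then show ?thesis using us'(3) lQ by simp
      next
        case 2
        then have "\<not> E p' x" "x \<notin> set us'" using P'(1) sub dj by blast+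
        then show ?thesis unfolding lQ using 2 by auto
      next
        case 3
        then have "x \<in> set xs" "x \<notin> set cs" "x \<notin> set us'" using sub dj xy by blast+
        then have "\<not> E p' x" "x \<notin> set (a # us')" using P'(1)[of x] ab by auto
        then show ?thesis unfolding lQ using last_in_set[of "a # us'"] by auto
      qed
    qed
    moreover have "set ?Q \<subseteq> lev r (Suc k)" using Qs sub l by blast
    moreover have "2 \<le> length ?Q" using A(5) by simp
    moreover have "odd (length ?Q + length R)" using A(7) by auto
    ultimately have "length ?Q + length R \<le> 7"
      using hole_below_bound[OF Q _ _ R p(1) p'(1) pp] by blast
    then show ?thesis using A(5) by simp
  qed
  obtain R where R: "ipath R" "R \<noteq> []" "hd R = p" "last R = p'" "set R \<subseteq> {p, p'} \<union> below r k"
    using lev_path[OF p(1) p'(1)] by blast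
  \<comment> \<open>If \<open>p\<close> and \<open>p'\<close> were adjacent, \<open>uniq'\<close>
    would leave the end of \<open>ys\<close> as the only neighbour of \<open>p'\<close> on its tail.
    The cut would then keep all 8 vertices of \<open>ys\<close>, against
    \<open>short\<close>.\<close>
  have npp: "\<not> E p p'"
  proof
    assume "E p p'"
    then have n: "\<not> E p' s" if "s \<in> set cs \<union> set (butlast ys)" for s
      using uniq'[of p s] that out(1) sym sy by blast
    have "E p' (last (a # us'))" using us'(3)[of "last (a # us')"] by (simp add: last_in_set)
    moreover have "last (a # us') \<in> set cs \<union> set ys" using ab us'(1) by (auto simp: last_in_set)
    ultimately have lu: "last (a # us') = last ys" using n sy by blast
    then have "us' \<noteq> []" using ab dj last_in_set[OF ne(2)] by auto
    moreover have "distinct ys" using y(1) ipath_distinct unfolding attached_def by fastforce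
    ultimately have "vs' = []"
      using lu us'(1) by (cases vs' rule: rev_cases) auto
    then show False using short[OF R] us'(1) y(2) by simp
  qed
  have len: "3 \<le> length R" using ipath_length_ge_3[OF R(1,2)] R(3,4) pp npp by simp
  have "us = []" "us' = []"
  proof -
    have "length us + length us' \<le> 1" using short[OF R] len by simp
    then show "us = []" "us' = []" using us(2) us'(2) by (auto simp: le_Suc_eq)
  qed
  then show ?thesis using us(3)[of b] us'(3)[of a] npp short by simp
qed

section \<open>Greedy choice of tails and of their ends, and the square among the
  grandparents\<close>

section \<open>Growing tails\<close>

text \<open>Otherwise a triangle or a 4-cycle through \<open>t\<close> and \<open>s\<close>
  arises.\<close>

lemma siblings_common_nbr:
  assumes "E t w" "E t w'" "s \<noteq> t" "w = s \<or> E w s" "w' = s \<or> E w' s"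
  shows "w = w'"
  using assms no_triangle[of t w w'] no_triangle[of t w' w] common_nbr[of w t s w'] sym by metis

text \<open>Each \<open>s\<close> in \<open>T\<close> other than \<open>t\<close> rules out at most
  one neighbour of \<open>t\<close> (\<open>B1\<close>), and each pair in \<open>T\<close> at most
  one through its common neighbour \<open>q w\<close> (\<open>B2\<close>). That makes at most 27 +
  351 = 378, so at least 350 of the 728 neighbours remain.\<close>

lemma children_exist:
  assumes H: "H \<subseteq> lev r (Suc k)" "\<And>v. v \<in> H \<Longrightarrow> 728 \<le> card {w \<in> H. E v w}"
    and q: "\<And>w. w \<in> H \<Longrightarrow> q w \<in> lev r k \<and> E (q w) w"
    and T: "finite T" "card T \<le> 27" "t \<in> H"
  shows "\<exists>W\<subseteq>H. card W = 10 \<and> inj_on q W \<and> W \<inter> T = {} \<and>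
    (\<forall>w\<in>W. E t w \<and> (\<forall>s\<in>T. s \<noteq> t \<longrightarrow> \<not> E w s) \<and>
       (\<forall>s\<in>T. \<forall>s'\<in>T. E (q w) s \<longrightarrow> E (q w) s' \<longrightarrow> s = s'))"
proof -
  have finH: "finite H" using H(1) finite_lev finite_subset by blast
  define N where "N = {w \<in> H. E t w}"
  have finN: "finite N" using finH unfolding N_def by simp
  have cN: "728 \<le> card N" using H(2) T(3) unfolding N_def by blast
  \<comment> \<open>Two neighbours of \<open>t\<close> with the same parent would form a 4-cycle
    with \<open>t\<close> and that parent, which differs from \<open>t\<close> because it lies one
    level lower.\<close>
  have inj: "w = w'" if "w \<in> N" "w' \<in> N" "q w = q w'" for w w'
  proof -
    have "E (q w) w" "E (q w) w'" "q w \<in> lev r k" "t \<in> lev r (Suc k)"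
      using q[of w] q[of w'] that H(1) T(3) unfolding N_def by auto
    moreover from this have "q w \<noteq> t" using lev_Suc_disjoint by blast
    ultimately show ?thesis
      using common_nbr[of t w w' "q w"] that unfolding N_def by blast
  qed
  define B1 where "B1 s = {w \<in> N. w = s \<or> E w s}" for s
  define B2 where "B2 S = {w \<in> N. \<forall>s\<in>S. E (q w) s}" for S
  define P where "P = {S. S \<subseteq> T \<and> card S = 2}"
  have c1: "card (B1 s) \<le> 1" if "s \<in> T - {t}" for s
    unfolding One_nat_def
  proof (subst card_le_Suc0_iff_eq)
    show "finite (B1 s)" using finN unfolding B1_def by simp
    show "\<forall>w\<in>B1 s. \<forall>w'\<in>B1 s. w = w'"
      using siblings_common_nbr[of t _ _ s] that unfolding B1_def N_def by blast
  qed
  have c2: "card (B2 S) \<le> 1" if SP: "S \<in> P" for S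
    unfolding One_nat_def
  proof (subst card_le_Suc0_iff_eq)
    show "finite (B2 S)" using finN unfolding B2_def by simp
    show "\<forall>w\<in>B2 S. \<forall>w'\<in>B2 S. w = w'"
    proof (intro ballI)
      fix w w' assume w: "w \<in> B2 S" "w' \<in> B2 S"
      obtain s s' where S: "S = {s, s'}" "s \<noteq> s'" using SP unfolding P_def card_2_iff by blast
      then have "q w = q w'" using common_nbr[of "q w" s s' "q w'"] w unfolding B2_def by blast
      then show "w = w'" using inj w unfolding B2_def by blast
    qed
  qed
  have finP: "finite P" using T(1) unfolding P_def by simp
  have "card (\<Union>s\<in>T - {t}. B1 s) \<le> (\<Sum>s\<in>T - {t}. card (B1 s))"
    using T(1) by (intro card_UN_le) simp
  also have "\<dots> \<le> (\<Sum>s\<in>T - {t}. 1)" using c1 by (rule sum_mono)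
  also have "\<dots> \<le> 27" using T card_mono[of T "T - {t}"] by simp
  finally have u1: "card (\<Union>s\<in>T - {t}. B1 s) \<le> 27" .
  have "card (\<Union>S\<in>P. B2 S) \<le> (\<Sum>S\<in>P. card (B2 S))"
    using finP by (rule card_UN_le)
  also have "\<dots> \<le> (\<Sum>S\<in>P. 1)" using c2 by (rule sum_mono)
  also have "\<dots> = card T choose 2" using n_subsets[OF T(1), of 2] unfolding P_def by simp
  also have "\<dots> \<le> 27 choose 2" using T(2) by (rule binomial_right_mono)
  also have "\<dots> = 351" by (simp add: choose_two)
  finally have u2: "card (\<Union>S\<in>P. B2 S) \<le> 351" .
  define bad where "bad = (\<Union>s\<in>T - {t}. B1 s) \<union> (\<Union>S\<in>P. B2 S)"
  have "card bad \<le> 378"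
    using card_Un_le[of "\<Union>s\<in>T - {t}. B1 s" "\<Union>S\<in>P. B2 S"] u1 u2 unfolding bad_def by linarith
  moreover have "card N - card bad \<le> card (N - bad)"
    by (rule diff_card_le_card_Diff)
       (use finN in \<open>auto intro: finite_subset[of _ N] simp: bad_def B1_def B2_def\<close>)
  ultimately have "10 \<le> card (N - bad)" using cN by linarith
  then obtain W where W: "W \<subseteq> N - bad" "card W = 10" using obtain_subset_with_card_n by metis
  show ?thesis
  proof (intro exI[of _ W] conjI ballI impI)
    show "W \<subseteq> H" "card W = 10" using W unfolding N_def by blast+
    show tw: "E t w" if "w \<in> W" for w using W that unfolding N_def by blast
    show "\<not> E w s" if "w \<in> W" "s \<in> T" "s \<noteq> t" for w s
      using W that unfolding bad_def B1_def by blast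
    have "w \<notin> T" if "w \<in> W" for w
      using W that tw[OF that] irrefl unfolding bad_def B1_def by blast
    then show "W \<inter> T = {}" by blast
    show "s = s'" if "w \<in> W" "s \<in> T" "s' \<in> T" "E (q w) s" "E (q w) s'" for w s s'
    proof (rule ccontr)
      assume "s \<noteq> s'"
      then have "{s, s'} \<in> P" using that unfolding P_def by simp
      moreover have "w \<in> B2 {s, s'}" using that W unfolding B2_def by auto
      ultimately show False using W(1) that(1) unfolding bad_def by blast
    qed
    show "inj_on q W" using inj W(1) by (intro inj_onI) blast
  qed
qed

text \<open>Greedy extension, each new vertex being supplied by \<open>children_exist\<close> for
  \<open>T\<close> and the tail so far. That lemma admits 27 vertices, which still covers the last
  of the \<open>n\<close> steps when \<open>card T + n\<close> is at most 28.\<close>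

lemma tail_exists:
  assumes H: "H \<subseteq> lev r (Suc k)" "\<And>v. v \<in> H \<Longrightarrow> 728 \<le> card {w \<in> H. E v w}"
    and T: "finite T" "b \<in> H" "b \<in> T"
  shows "card T + n \<le> 28 \<Longrightarrow> \<exists>xs. length xs = n \<and> set xs \<subseteq> H \<and> attached T b xs"
proof (induction n)
  case 0
  then show ?case using T by simp
next
  case (Suc n)
  then obtain xs where xs: "length xs = n" "set xs \<subseteq> H" "attached T b xs" by auto
  have "\<exists>p\<in>lev r k. E p w" if "w \<in> H" for w using lev_parent H(1) that by blast
  then obtain q where q: "\<And>w. w \<in> H \<Longrightarrow> q w \<in> lev r k \<and> E (q w) w" by metis
  have "card (T \<union> set xs) \<le> 27"
    using card_Un_le[of T "set xs"] card_length[of xs] Suc.prems xs(1) by linarith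
  moreover have "last (b # xs) \<in> H" using T xs(2) by (auto simp: last_in_set subset_iff)
  ultimately obtain W where W: "W \<subseteq> H" "card W = 10" "\<And>w. w \<in> W \<Longrightarrow> E (last (b # xs)) w"
     "W \<inter> (T \<union> set xs) = {}"
     "\<And>w s. w \<in> W \<Longrightarrow> s \<in> T \<union> set xs \<Longrightarrow> s \<noteq> last (b # xs) \<Longrightarrow> \<not> E w s"
    using children_exist[OF H q, of "T \<union> set xs" "last (b # xs)"] T(1) by blast
  have "W \<noteq> {}" using W(2) by auto
  then obtain w where w: "w \<in> W" by blast
  have "E w s \<longleftrightarrow> s = last (b # xs)" if "s \<in> T \<union> set xs" for s
    using W(3)[OF w] W(5)[OF w that] sym by blast
  moreover have "w \<notin> T \<union> set xs" using W(4) w by blast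
  ultimately have "attached T b (xs @ [w])" by (intro attached_snoc xs)
  then show ?case using xs W(1) w by (intro exI[of _ "xs @ [w]"]) auto
qed

text \<open>Let \<open>f\<close> choose a parent of each \<open>p\<close>. A pair with none of the
  three contacts in \<open>key\<close> would be joined by a path with at least 5 vertices, against
  \<open>short\<close>. Contacts of the first two kinds are few, so many of the vertices
  \<open>f p\<close> and \<open>f p'\<close> are adjacent, and pigeonhole gives a 4-cycle among
  them.\<close>

lemma no_grid:
  assumes P: "P \<subseteq> lev r k" "card P = 3" "\<And>p. p \<in> P \<Longrightarrow> E p b"
    and P': "P' \<subseteq> lev r k" "card P' = 10" "\<And>p. p \<in> P' \<Longrightarrow> E p a"
    and ab: "a \<in> lev r (Suc k)" "b \<in> lev r (Suc k)"
    and pp: "\<And>p p'. p \<in> P \<Longrightarrow> p' \<in> P' \<Longrightarrow> p \<noteq> p' \<and> \<not> E p p'"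
    and short: "\<And>p p' R. p \<in> P \<Longrightarrow> p' \<in> P' \<Longrightarrow> ipath R \<Longrightarrow> R \<noteq> [] \<Longrightarrow> hd R = p \<Longrightarrow> last R = p' \<Longrightarrow>
        set R \<subseteq> {p, p'} \<union> below r k \<Longrightarrow> length R \<le> 4"
  shows False
proof -
  have fin: "finite P" "finite P'" using P(2) P'(2) by (auto intro: card_ge_0_finite)
  have "k \<noteq> 0"
  proof
    assume "k = 0"
    then have "card P \<le> card {r}" using P(1) by (intro card_mono) auto
    then show False using P(2) by simp
  qed
  then obtain j where k: "k = Suc j" by (cases k) auto
  have "\<exists>q\<in>lev r j. E q p" if "p \<in> lev r k" for p using lev_parent that unfolding k by blast
  then obtain f where f: "\<And>p. p \<in> lev r k \<Longrightarrow> f p \<in> lev r j" "\<And>p. p \<in> lev r k \<Longrightarrow> E (f p) p" by metis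
  have fab: "f p \<noteq> a" "f p \<noteq> b" if "p \<in> lev r k" for p
    using f(1)[OF that] ab lev_unique[of _ r j "Suc k"] k by auto
  have f_inj: "p1 = p2" if "p1 \<in> lev r k" "p2 \<in> lev r k" "E q p1" "E q p2" "E p1 c" "E p2 c" "q \<noteq> c"
    for p1 p2 q c
    using common_nbr[of q p1 p2 c] that sym by blast
  have key: "E (f p) p' \<or> E (f p') p \<or> E (f p) (f p')" if pp': "p \<in> P" "p' \<in> P'" for p p'
  proof (rule ccontr)
    assume n: "\<not> ?thesis"
    have l: "p \<in> lev r k" "p' \<in> lev r k" using pp' P P' by auto
    obtain R where R: "ipath R" "R \<noteq> []" "hd R = p" "last R = p'" "5 \<le> length R"
      "set R \<subseteq> {p, p'} \<union> below r k"
      using ipath_extend_below[of p r j p' "f p" "f p'"] l f[OF l(1)] f[OF l(2)] pp[OF pp'] n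
      unfolding k by blast
    show False using short[OF pp' R(1-4,6)] R(5) by simp
  qed
  \<comment> \<open>Each \<open>f p\<close> sees at most one element of \<open>P'\<close>, since
    these already share the neighbour \<open>a\<close>. So at most 3 of the 10 are lost.\<close>
  define Q where "Q = {p' \<in> P'. \<forall>p\<in>P. \<not> E (f p) p'}"
  have "card {p' \<in> P'. E (f p) p'} \<le> 1" if "p \<in> P" for p
    unfolding One_nat_def
  proof (subst card_le_Suc0_iff_eq)
    show "finite {p' \<in> P'. E (f p) p'}" using fin by simp
    show "\<forall>x\<in>{p' \<in> P'. E (f p) p'}. \<forall>y\<in>{p' \<in> P'. E (f p) p'}. x = y"
      using f_inj[of _ _ "f p" a] P' fab(1)[of p] P(1) that by blast
  qed
  then have "(\<Sum>p\<in>P. card {p' \<in> P'. E (f p) p'}) \<le> (\<Sum>p\<in>P. 1)" by (rule sum_mono)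
  then have "card (\<Union>p\<in>P. {p' \<in> P'. E (f p) p'}) \<le> 3"
    using card_UN_le[OF fin(1), of "\<lambda>p. {p' \<in> P'. E (f p) p'}"] P(2) by simp
  moreover have "Q = P' - (\<Union>p\<in>P. {p' \<in> P'. E (f p) p'})" unfolding Q_def by blast
  then have "card P' - card (\<Union>p\<in>P. {p' \<in> P'. E (f p) p'}) \<le> card Q"
    using fin by (auto intro: diff_card_le_card_Diff)
  ultimately have cQ: "4 \<le> card Q" using P'(2) by linarith
  have "P \<noteq> {}" using P(2) by auto
  \<comment> \<open>For \<open>q\<close> in \<open>Q\<close>, the vertex \<open>f q\<close> sees at
    most one element of \<open>P\<close>, since these share the neighbour \<open>b\<close>. That
    element is the exception \<open>g\<close>; for the others \<open>key\<close> leaves only the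
    edge between \<open>f p\<close> and \<open>f q\<close>.\<close>
  have "\<exists>g\<in>P. \<forall>p\<in>P. p \<noteq> g \<longrightarrow> E (f p) (f q)" if q: "q \<in> Q" for q
  proof -
    have qP: "q \<in> P'" "q \<in> lev r k" using q P' unfolding Q_def by auto
    have e: "E (f q) p \<or> E (f p) (f q)" if "p \<in> P" for p
      using key[OF that qP(1)] q that unfolding Q_def by blast
    show ?thesis
    proof (cases "\<exists>g\<in>P. E (f q) g")
      case True
      then obtain g where g: "g \<in> P" "E (f q) g" by blast
      have "\<not> E (f q) p" if "p \<in> P" "p \<noteq> g" for p
        using f_inj[of p g "f q" b] that g P fab(2)[OF qP(2)] by blast
      then show ?thesis using e g(1) by blast
    next
      case False
      then show ?thesis using e \<open>P \<noteq> {}\<close> by blast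
    qed
  qed
  then obtain g where g: "\<And>q. q \<in> Q \<Longrightarrow> g q \<in> P" "\<And>q p. q \<in> Q \<Longrightarrow> p \<in> P \<Longrightarrow> p \<noteq> g q \<Longrightarrow> E (f p) (f q)"
    by metis
  \<comment> \<open>\<open>Q\<close> has at least 4 elements and there are only 3 exceptions, so two
    elements of \<open>Q\<close> share theirs. The parents of both are adjacent to the parents of
    the other two elements of \<open>P\<close>.\<close>
  have "card (g ` Q) \<le> 3" using card_mono[OF fin(1), of "g ` Q"] g(1) P(2) by auto
  then have "\<not> inj_on g Q" using card_image[of g Q] cQ by auto
  then obtain q1 q2 where q: "q1 \<in> Q" "q2 \<in> Q" "q1 \<noteq> q2" "g q1 = g q2" unfolding inj_on_def by blast
  have "card (P - {g q1}) = 2" using P(2) g(1)[OF q(1)] fin by simp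
  then obtain p1 p2 where p: "P - {g q1} = {p1, p2}" "p1 \<noteq> p2" unfolding card_2_iff by blast
  have pin: "p1 \<in> P" "p2 \<in> P" "p1 \<noteq> g q1" "p2 \<noteq> g q1" using p by blast+
  have qin: "q1 \<in> P'" "q2 \<in> P'" using q unfolding Q_def by auto
  have "f p1 \<noteq> f p2"
    using f_inj[of p1 p2 "f p1" b] f(2)[of p1] f(2)[of p2] fab(2)[of p1] pin P p(2) by (metis subset_iff)
  moreover have "f q1 \<noteq> f q2"
    using f_inj[of q1 q2 "f q1" a] f(2)[of q1] f(2)[of q2] fab(1)[of q1] qin P' q(3) by (metis subset_iff)
  moreover have "E (f p1) (f q1)" "E (f p1) (f q2)" "E (f p2) (f q1)" "E (f p2) (f q2)"
    using g(2) q pin by auto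
  ultimately show False using common_nbr by blast
qed

text \<open>The constants fit together as follows: an odd hole has at most 7 vertices, and with two
  tails of 7 vertices this makes at most 21. Three ends for the first tail and their parents bring
  the total to 27, the capacity of \<open>children_exist\<close>, before the 10 ends of the second
  tail are chosen.\<close>

lemma level_728_colorable: "colorable (lev r k) 728"
proof (rule ccontr)
  assume "\<not> ?thesis"
  then obtain H where H: "H \<subseteq> lev r k" "\<not> colorable H 728" "\<And>v. v \<in> H \<Longrightarrow> colorable (H - {v}) 728"
    using critical_subset[OF finite_lev] by blast
  have finH: "finite H" using H(1) finite_lev finite_subset by blast
  have deg: "728 \<le> card {w \<in> H. E v w}" if "v \<in> H" for v
    using critical_degree[OF finH H(2) that H(3)[OF that]] .
  have "\<not> colorable H 2" using H(2) colorable_mono[of H 2 728] by auto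
  then obtain cs where cs: "icyc cs" "odd (length cs)" "set cs \<subseteq> H"
    using odd_icyc_exists[OF finH] no_triangle by blast
  have "length cs < 9" "length cs \<noteq> 8" using no_long_odd_hole[OF cs(1,2)] cs(2) by auto
  then have len: "card (set cs) \<le> 7" using card_length[of cs] by linarith
  \<comment> \<open>The first and the third vertex of the hole serve as the nonadjacent pair
    \<open>a\<close>, \<open>b\<close>.\<close>
  obtain c cs' where c: "cs = c # cs'" "3 \<le> length cs'" using cs(1) by (cases cs) (auto simp: icyc_def)
  obtain b1 b rest where c': "cs' = b1 # b # rest" "rest \<noteq> []"
    using c(2) by (cases cs'; cases "tl cs'"; cases "tl (tl cs')") auto
  define a where "a = c"
  have ab: "a \<in> set cs" "b \<in> set cs" "a \<noteq> b" "\<not> E b a"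
  proof -
    have "E c b \<longleftrightarrow> b = b1 \<or> b = last rest" "c \<noteq> b" "b \<noteq> b1" "b \<notin> set rest"
      using cs(1) c' unfolding c(1) icyc_Cons by auto
    then show "a \<in> set cs" "b \<in> set cs" "a \<noteq> b" "\<not> E b a"
      using c(1) c' last_in_set[of rest] sym unfolding a_def by auto
  qed
  have "k \<noteq> 0"
    using H(1) cs(3) ab by (cases k) auto
  then obtain k' where k: "k = Suc k'" by (cases k) auto
  have H': "H \<subseteq> lev r (Suc k')" using H(1) k by simp
  have "\<exists>p\<in>lev r k'. E p w" if "w \<in> H" for w using lev_parent H' that by blast
  then obtain q where q: "\<And>w. w \<in> H \<Longrightarrow> q w \<in> lev r k' \<and> E (q w) w" by metis
  have ql: "q w \<notin> H" if "w \<in> H" for w using q[OF that] lev_Suc_disjoint H' by blast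
  obtain xs where xs: "length xs = 7" "set xs \<subseteq> H" "attached (set cs) b xs"
    using tail_exists[OF H' deg, of "set cs" b 7] ab cs(3) len by auto
  have "card (set cs \<union> set xs) \<le> 14"
    using card_Un_le[of "set cs" "set xs"] card_length[of xs] len xs(1) by linarith
  \<comment> \<open>Attaching \<open>ys\<close> to the hole together with \<open>xs\<close> keeps
    the two tails free of contact.\<close>
  then obtain ys where ys: "length ys = 7" "set ys \<subseteq> H" "attached (set cs \<union> set xs) a ys"
    using tail_exists[OF H' deg, of "set cs \<union> set xs" a 7] ab cs(3) by auto
  define T where "T = set cs \<union> set xs \<union> set ys"
  have finT: "finite T" unfolding T_def by simp
  have TH: "T \<subseteq> H" using cs(3) xs(2) ys(2) unfolding T_def by blast
  have cT: "card T \<le> 21"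
    using card_Un_le[of "set cs \<union> set xs" "set ys"] card_length[of ys] ys(1) \<open>card (set cs \<union> set xs) \<le> 14\<close>
    unfolding T_def by linarith
  have ne: "xs \<noteq> []" "ys \<noteq> []" using xs(1) ys(1) by auto
  then have lst: "last xs \<in> set xs" "last ys \<in> set ys" by auto
  have lT: "last xs \<in> T" "last ys \<in> T" using lst unfolding T_def by auto
  have "last xs \<in> H" "last ys \<in> H" using lT TH by auto
  have cT27: "card T \<le> 27" using cT by simp
  obtain W0 where W0: "W0 \<subseteq> H" "card W0 = 10" "\<And>w. w \<in> W0 \<Longrightarrow> E (last xs) w" "W0 \<inter> T = {}"
    "\<And>w s. w \<in> W0 \<Longrightarrow> s \<in> T \<Longrightarrow> s \<noteq> last xs \<Longrightarrow> \<not> E w s"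
    "\<And>w s s'. w \<in> W0 \<Longrightarrow> s \<in> T \<Longrightarrow> s' \<in> T \<Longrightarrow> E (q w) s \<Longrightarrow> E (q w) s' \<Longrightarrow> s = s'"
    "inj_on q W0"
    using children_exist[OF H' deg q finT _ \<open>last xs \<in> H\<close>] cT27 by blast
  obtain W where W: "W \<subseteq> W0" "card W = 3" using obtain_subset_with_card_n[of 3 W0] W0(2) by auto
  \<comment> \<open>Including the parents of \<open>W\<close> makes the new ends avoid them and lets
    uniqueness for \<open>q z\<close> also speak about \<open>q w\<close>.\<close>
  define T' where "T' = T \<union> W \<union> q ` W"
  have finW: "finite W" using W(2) by (auto intro: card_ge_0_finite)
  have finT': "finite T'" using finT finW unfolding T'_def by simp
  have cT': "card T' \<le> 27"
    using card_Un_le[of "T \<union> W" "q ` W"] card_Un_le[of T W] card_image_le[OF finW, of q] W(2) cT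
    unfolding T'_def by linarith
  obtain Z where Z: "Z \<subseteq> H" "card Z = 10" "\<And>z. z \<in> Z \<Longrightarrow> E (last ys) z" "Z \<inter> T' = {}"
    "\<And>z s. z \<in> Z \<Longrightarrow> s \<in> T' \<Longrightarrow> s \<noteq> last ys \<Longrightarrow> \<not> E z s"
    "\<And>z s s'. z \<in> Z \<Longrightarrow> s \<in> T' \<Longrightarrow> s' \<in> T' \<Longrightarrow> E (q z) s \<Longrightarrow> E (q z) s' \<Longrightarrow> s = s'"
    "inj_on q Z"
    using children_exist[OF H' deg q finT' cT' \<open>last ys \<in> H\<close>] by blast
  have WH: "W \<subseteq> H" using W W0 by blast
  have dj: "set xs \<inter> set cs = {}" "set ys \<inter> (set cs \<union> set xs) = {}"
    using xs(3) ys(3) unfolding attached_def by auto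
  have grid: "E (q w) b \<and> E (q z) a \<and> \<not> E (q w) (q z) \<and>
      (\<forall>R. ipath R \<and> R \<noteq> [] \<and> hd R = q w \<and> last R = q z \<and> set R \<subseteq> {q w, q z} \<union> below r k' \<longrightarrow>
         length R \<le> 4)"
    if w: "w \<in> W" and z: "z \<in> Z" for w z
  proof (rule tail_ends_at_cycle[where xs = "xs @ [w]" and ys = "ys @ [z]"])
    have w0: "w \<in> W0" "w \<in> H" "z \<in> H" using w z W W0 Z by auto
    have wT: "w \<notin> T" "z \<notin> T" "z \<noteq> w" using w z w0 W0(4) Z(4) unfolding T'_def by auto
    have we: "E w s \<longleftrightarrow> s = last xs" if "s \<in> T" for s
      using W0(3,5) w0 that sym by blast
    have ze: "E z s \<longleftrightarrow> s = last ys" if "s \<in> T \<union> {w}" for s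
      using Z(3)[OF z] Z(5)[OF z, of s] that w sym unfolding T'_def by blast
    have wz: "\<not> E w z" "\<not> E z w" using ze[of w] lT wT sym by auto
    show "icyc cs" "odd (length cs)" "a \<noteq> b" "\<not> E b a" by fact+
    show "attached (set cs) b (xs @ [w])"
      using xs(3) wT we ne unfolding T_def by (intro attached_snoc) auto
    have "attached (set cs) a ys" using attached_mono[OF ys(3)] ab by blast
    then show "attached (set cs) a (ys @ [z])"
      using wT ze ne unfolding T_def by (intro attached_snoc) auto
    show "length (xs @ [w]) = 8" "length (ys @ [z]) = 8" using xs(1) ys(1) by auto
    show "set (xs @ [w]) \<inter> set (ys @ [z]) = {}" using dj wT unfolding T_def by auto
    show "\<not> E x y" if "x \<in> set (xs @ [w])" "y \<in> set (ys @ [z])" for x y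
    proof -
      consider "x \<in> set xs" "y \<in> set ys" | "x = w" "y \<in> set ys" | "x \<in> set xs" "y = z" | "x = w" "y = z"
        using \<open>x \<in> _\<close> \<open>y \<in> _\<close> by auto
      then show ?thesis
      proof cases
        case 1
        have "x \<noteq> a" using 1 ab dj by blast
        then show ?thesis using ys(3) 1 sym unfolding attached_def by blast
      next
        case 2
        then show ?thesis using we[of y] lst dj unfolding T_def by blast
      next
        case 3
        then show ?thesis using ze[of x] lst dj sym unfolding T_def by blast
      next
        case 4
        then show ?thesis using wz by simp
      qed
    qed
    show "set cs \<union> set (xs @ [w]) \<union> set (ys @ [z]) \<subseteq> lev r (Suc k')"
      using TH w0 H' unfolding T_def by auto
    show "q w \<in> lev r k'" "q z \<in> lev r k'" "E (q w) (last (xs @ [w]))" "E (q z) (last (ys @ [z]))"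
      using q w0 by auto
    \<comment> \<open>The ends in \<open>Z\<close> have no neighbour in \<open>T'\<close> except
      \<open>last ys\<close>, from which \<open>q w\<close> is separated by its level.\<close>
    have qz: "q w \<noteq> last ys" using ql[OF w0(2)] lT TH by auto
    have "\<not> E z (q w)" using Z(5)[OF z _ qz] w unfolding T'_def by blast
    then show "\<not> E (q w) (last (ys @ [z]))" using sym by auto
    have "T \<subseteq> T'" "w \<in> T'" "q w \<in> T'" using w unfolding T'_def by auto
    show "s = t" if "s \<in> set cs \<union> set (butlast (xs @ [w])) \<union> set (butlast (ys @ [z]))"
      "t \<in> set cs \<union> set (butlast (xs @ [w])) \<union> set (butlast (ys @ [z]))"
      "E (q w) s" "E (q w) t" for s t
      using W0(6)[OF w0(1), of s t] that unfolding T_def by simp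
    show "s = t" if "s \<in> insert (q w) (set cs \<union> set (xs @ [w]) \<union> set (butlast (ys @ [z])))"
      "t \<in> insert (q w) (set cs \<union> set (xs @ [w]) \<union> set (butlast (ys @ [z])))"
      "E (q z) s" "E (q z) t" for s t
      using Z(6)[OF z, of s t] that \<open>T \<subseteq> T'\<close> \<open>w \<in> T'\<close> \<open>q w \<in> T'\<close> unfolding T_def by auto
  qed
  show False
  proof (rule no_grid[of "q ` W" r k' b "q ` Z" a])
    have iW: "inj_on q W" using W0(7) W(1) by (rule inj_on_subset)
    show "card (q ` W) = 3" "card (q ` Z) = 10"
      using card_image[OF iW] card_image[OF Z(7)] W(2) Z(2) by simp_all
    show "q ` W \<subseteq> lev r k'" "q ` Z \<subseteq> lev r k'" using q WH Z(1) by auto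
    show "a \<in> lev r (Suc k')" "b \<in> lev r (Suc k')" using ab cs(3) H' by auto
    have "Z \<noteq> {}" "W \<noteq> {}" using Z(2) W(2) by auto
    then show "E p b" if "p \<in> q ` W" for p using grid that by blast
    show "E p a" if "p \<in> q ` Z" for p using grid that \<open>W \<noteq> {}\<close> by blast
    show "p \<noteq> p' \<and> \<not> E p p'" if pq: "p \<in> q ` W" "p' \<in> q ` Z" for p p'
    proof -
      obtain w z where wz: "w \<in> W" "z \<in> Z" "p = q w" "p' = q z" using pq by blast
      have "w \<in> H" using wz(1) WH by blast
      then have "q w \<noteq> last ys" using ql \<open>last ys \<in> H\<close> by metis
      then have "\<not> E z (q w)" using Z(5)[OF wz(2), of "q w"] wz(1) unfolding T'_def by blast
      moreover have "E (q z) z" using q wz(2) Z(1) by blast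
      ultimately have "q w \<noteq> q z" using sym by metis
      then show ?thesis using grid[OF wz(1,2)] wz by blast
    qed
    show "length R \<le> 4" if "p \<in> q ` W" "p' \<in> q ` Z" "ipath R" "R \<noteq> []" "hd R = p" "last R = p'"
      "set R \<subseteq> {p, p'} \<union> below r k'" for p p' R
      using grid that by blast
  qed
qed

end

section \<open>Heptagons in a level, their parents and grandparents\<close>

section \<open>Graphs without pentagons\<close>

locale heptagonal = long_odd_hole_free +
  assumes no_pentagon: "icyc cs \<Longrightarrow> length cs \<noteq> 5"
begin

lemma no_closed_5_walk: "E a b \<Longrightarrow> E b c \<Longrightarrow> E c d \<Longrightarrow> E d e \<Longrightarrow> \<not> E e a"
  using closed_5_walk no_pentagon[of "[a, b, c, d, e]"] by auto

text \<open>A second neighbour at distance 1, 2 or 3 from \<open>c0\<close> on the heptagon would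
  give a triangle, a 4-cycle or a closed walk of length 5.\<close>

lemma heptagon_nbr:
  assumes C: "icyc [c0, c1, c2, c3, c4, c5, c6]"
    and "E p c0" "p \<notin> {c0, c1, c2, c3, c4, c5, c6}"
    and "x \<in> {c0, c1, c2, c3, c4, c5, c6}"
  shows "E p x \<longleftrightarrow> x = c0"
proof -
  note a = heptagon_adj[OF C]
  have d: "c0 \<noteq> c2" "c0 \<noteq> c5" using C by (auto simp: icyc_def)
  have "\<not> E p c1" "\<not> E p c6" using a assms(2) no_triangle sym by blast+
  moreover have "\<not> E p c2" "\<not> E p c5"
    using common_nbr[of p c0 c2 c1] common_nbr[of p c0 c5 c6] a assms(2,3) d sym by blast+
  moreover have "\<not> E p c3" using no_closed_5_walk[of p c0 c1 c2 c3] a assms(2) sym by blast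
  moreover have "\<not> E p c4" using no_closed_5_walk[of p c0 c6 c5 c4] a assms(2) sym by blast
  ultimately show ?thesis using assms(2,4) by blast
qed

text \<open>The arcs between \<open>c0\<close> and \<open>c2\<close> have 6 and 3 vertices. A common
  parent of \<open>p0\<close> and \<open>p2\<close> gives a path with 3 vertices, too long for the
  arc of 6. Distinct nonadjacent parents give a path with at least 5 vertices, too long for
  whichever arc has the other parity.\<close>

lemma heptagon_dist_2:
  assumes C: "icyc [c0, c1, c2, c3, c4, c5, c6]"
    and l: "{c0, c1, c2, c3, c4, c5, c6} \<subseteq> lev r (Suc (Suc k))"
    and p: "p0 \<in> lev r (Suc k)" "p2 \<in> lev r (Suc k)" "E p0 c0" "E p2 c2"
    and q: "q0 \<in> lev r k" "q2 \<in> lev r k" "E q0 p0" "E q2 p2"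
  shows "E q0 q2"
proof (rule ccontr)
  assume nq: "\<not> E q0 q2"
  note a = heptagon_adj[OF C]
  have out: "p0 \<notin> {c0, c1, c2, c3, c4, c5, c6}" "p2 \<notin> {c0, c1, c2, c3, c4, c5, c6}"
    using lev_Suc_disjoint[OF p(1)] lev_Suc_disjoint[OF p(2)] l by blast+
  have n0: "E p0 x \<longleftrightarrow> x = c0" if "x \<in> {c0, c1, c2, c3, c4, c5, c6}" for x
    using heptagon_nbr[OF C p(3) out(1) that] .
  have n2: "E p2 x \<longleftrightarrow> x = c2" if "x \<in> {c0, c1, c2, c3, c4, c5, c6}" for x
    using heptagon_nbr[OF heptagon_rotate[OF heptagon_rotate[OF C]] p(4)] out(2) that by blast
  have "c0 \<noteq> c2" using C by (auto simp: icyc_def)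
  then have pp: "p0 \<noteq> p2" using n0[of c2] n2[of c2] by auto
  have npp: "\<not> E p0 p2" using no_closed_5_walk[of p0 c0 c1 c2 p2] a p sym by blast
  have Q: "ipath [c0, c6, c5, c4, c3, c2]" "ipath [c0, c1, c2]"
    using C by (auto simp: icyc_def sym_iff)
  have bound: "length Q + length R \<le> 7"
    if "ipath R" "R \<noteq> []" "hd R = p0" "last R = p2" "set R \<subseteq> {p0, p2} \<union> below r (Suc k)"
      "Q \<in> {[c0, c6, c5, c4, c3, c2], [c0, c1, c2]}" "odd (length Q + length R)" for Q R
  proof (rule hole_below_bound[where p = p0 and p' = p2 and r = r and k = "Suc k"])
    have s: "set Q \<subseteq> {c0, c1, c2, c3, c4, c5, c6}" "hd Q = c0" "last Q = c2"
      using that(6) by auto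
    show "ipath Q" "2 \<le> length Q" using that(6) Q by auto
    show "set Q \<subseteq> lev r (Suc (Suc k))" using s(1) l by blast
    show "E p0 x \<longleftrightarrow> x = hd Q" "E p2 x \<longleftrightarrow> x = last Q" if "x \<in> set Q" for x
      unfolding s(2,3) using n0[of x] n2[of x] s(1) that by blast+
  qed (fact that p pp)+
  have nc: False if "E q p0" "E q p2" "q \<in> lev r k" for q
  proof -
    have "q \<noteq> p0" "q \<noteq> p2" using lev_unique[of q r k "Suc k"] that p by auto
    then have "ipath [p0, q, p2]" using that npp pp sym by auto
    moreover have "q \<in> below r (Suc k)" using that unfolding below_def by blast
    ultimately show False
      using bound[of "[p0, q, p2]" "[c0, c6, c5, c4, c3, c2]"] by auto
  qed
  have "\<not> E q0 p2" "\<not> E q2 p0" using nc q by blast+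
  then obtain R where R: "ipath R" "R \<noteq> []" "hd R = p0" "last R = p2" "5 \<le> length R"
    "set R \<subseteq> {p0, p2} \<union> below r (Suc k)"
    using ipath_extend_below[OF p(1,2) pp npp q _ _ nq] by blast
  show False
    using bound[of R "[c0, c6, c5, c4, c3, c2]"] bound[of R "[c0, c1, c2]"] R by (cases "odd (length R)") auto
qed

text \<open>The arcs between \<open>c0\<close> and \<open>c3\<close> have 5 and 4 vertices, so an
  induced path below between nonadjacent parents has exactly 3 and runs through a common parent
  \<open>q\<close>. As \<open>heptagon_dist_2\<close> holds for every choice of grandparents,
  \<open>q\<close> can stand for positions 0 and 3 at once, and the grandparents at positions 2, 4,
  6, 1 close a walk of length 5 with it.\<close>

lemma heptagon_dist_3:
  assumes C: "icyc [c0, c1, c2, c3, c4, c5, c6]"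
    and l: "{c0, c1, c2, c3, c4, c5, c6} \<subseteq> lev r (Suc (Suc k))"
    and p: "\<And>c. c \<in> {c0, c1, c2, c3, c4, c5, c6} \<Longrightarrow> p c \<in> lev r (Suc k) \<and> E (p c) c"
  shows "E (p c0) (p c3)"
proof (rule ccontr)
  assume npp: "\<not> E (p c0) (p c3)"
  note a = heptagon_adj[OF C]
  note C1 = heptagon_rotate[OF C]
  note C2 = heptagon_rotate[OF C1]
  note C3 = heptagon_rotate[OF C2]
  note C4 = heptagon_rotate[OF C3]
  note C6 = heptagon_rotate[OF heptagon_rotate[OF C4]]
  have out: "p c \<notin> {c0, c1, c2, c3, c4, c5, c6}" if "c \<in> {c0, c1, c2, c3, c4, c5, c6}" for c
    using lev_Suc_disjoint[of "p c" r "Suc k"] l p[OF that] by blast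
  have n0: "E (p c0) x \<longleftrightarrow> x = c0" if "x \<in> {c0, c1, c2, c3, c4, c5, c6}" for x
    using heptagon_nbr[OF C] p out that by blast
  have n3: "E (p c3) x \<longleftrightarrow> x = c3" if "x \<in> {c0, c1, c2, c3, c4, c5, c6}" for x
    using heptagon_nbr[OF C3, of "p c3"] p[of c3] out[of c3] that by blast
  have "c0 \<noteq> c3" using C by (auto simp: icyc_def)
  then have pp: "p c0 \<noteq> p c3" using n0[of c3] n3[of c3] by auto
  have Q: "ipath [c0, c6, c5, c4, c3]" "ipath [c0, c1, c2, c3]"
    using C by (auto simp: icyc_def sym_iff)
  obtain R where R: "ipath R" "R \<noteq> []" "hd R = p c0" "last R = p c3"
      "set R \<subseteq> {p c0, p c3} \<union> below r (Suc k)"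
    using lev_path[of "p c0" r "Suc k" "p c3"] p by blast
  have "3 \<le> length R" using ipath_length_ge_3[of R] R pp npp by simp
  have bound: "length Q + length R \<le> 7"
    if "Q \<in> {[c0, c6, c5, c4, c3], [c0, c1, c2, c3]}" "odd (length Q + length R)" for Q
  proof (rule hole_below_bound[where p = "p c0" and p' = "p c3" and r = r and k = "Suc k"])
    have s: "set Q \<subseteq> {c0, c1, c2, c3, c4, c5, c6}" "hd Q = c0" "last Q = c3"
      using that(1) by auto
    show "ipath Q" "2 \<le> length Q" using that(1) Q by auto
    show "set Q \<subseteq> lev r (Suc (Suc k))" using s(1) l by blast
    show "E (p c0) x \<longleftrightarrow> x = hd Q" "E (p c3) x \<longleftrightarrow> x = last Q" if "x \<in> set Q" for x
      unfolding s(2,3) using n0[of x] n3[of x] s(1) that by blast+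
    show "p c0 \<in> lev r (Suc k)" "p c3 \<in> lev r (Suc k)" using p by simp_all
  qed (fact that pp R)+
  have "length R = 3"
    using bound[of "[c0, c6, c5, c4, c3]"] bound[of "[c0, c1, c2, c3]"] \<open>3 \<le> length R\<close>
    by (cases "odd (length R)") auto
  then obtain q where q: "R = [p c0, q, p c3]"
    using R(3,4) by (auto simp: length_Suc_conv numeral_3_eq_3)
  then have qE: "E q (p c0)" "E q (p c3)" using R(1) sym by auto
  have "q \<in> below r (Suc k)" using q R(1,5) by auto
  then obtain j where j: "j < Suc k" "q \<in> lev r j" unfolding below_def by auto
  then have ql: "q \<in> lev r k" using lev_edge[of q r j "p c0" "Suc k"] qE p[of c0] by (simp add: less_Suc_eq_le)
  have "\<exists>q\<in>lev r k. E q (p c)" if "c \<in> {c0, c1, c2, c3, c4, c5, c6}" for c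
    using lev_parent p[OF that] by blast
  then obtain f where f: "\<And>c. c \<in> {c0, c1, c2, c3, c4, c5, c6} \<Longrightarrow> f c \<in> lev r k \<and> E (f c) (p c)"
    by metis
  have "E q (f c2)" using heptagon_dist_2[OF C l, of "p c0" "p c2"] p f ql qE by blast
  moreover have "E (f c2) (f c4)"
    by (rule heptagon_dist_2[OF C2, of r k "p c2" "p c4"]) (use p f l in auto)
  moreover have "E (f c4) (f c6)"
    by (rule heptagon_dist_2[OF C4, of r k "p c4" "p c6"]) (use p f l in auto)
  moreover have "E (f c6) (f c1)"
    by (rule heptagon_dist_2[OF C6, of r k "p c6" "p c1"]) (use p f l in auto)
  moreover have "E (f c1) q"
    by (rule heptagon_dist_2[OF C1, of r k "p c1" "p c3"]) (use p f l ql qE in auto)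
  ultimately show False using no_closed_5_walk by blast
qed

lemma level_2_colorable: "colorable (lev r k) 2"
proof (rule ccontr)
  assume "\<not> ?thesis"
  then obtain cs where cs: "icyc cs" "odd (length cs)" "set cs \<subseteq> lev r k"
    using odd_icyc_exists[OF finite_lev] no_triangle by blast
  have "4 \<le> length cs" "length cs < 9" "length cs \<noteq> 5"
    using cs no_long_odd_hole no_pentagon by (auto simp: icyc_def)
  then have "length cs \<in> {4, 6, 7, 8}" by auto
  then have "length cs = 7" using cs(2) by auto
  then obtain c0 c1 c2 c3 c4 c5 c6 where c: "cs = [c0, c1, c2, c3, c4, c5, c6]"
    by (auto simp: length_Suc_conv eval_nat_numeral)
  note C = cs(1)[unfolded c]
  note a = heptagon_adj[OF C]
  have l: "{c0, c1, c2, c3, c4, c5, c6} \<subseteq> lev r k" using cs(3) c by simp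
  have "k \<noteq> 0" using l a irrefl by (cases k) auto
  then obtain k' where k': "k = Suc k'" by (cases k) auto
  have "\<exists>p\<in>lev r k'. E p c" if "c \<in> {c0, c1, c2, c3, c4, c5, c6}" for c
    using lev_parent l that unfolding k' by blast
  then obtain p where p: "\<And>c. c \<in> {c0, c1, c2, c3, c4, c5, c6} \<Longrightarrow> p c \<in> lev r k' \<and> E (p c) c"
    by metis
  \<comment> \<open>In level 1 the root is everybody's parent, and two adjacent vertices would form
    a triangle with it.\<close>
  have "k' \<noteq> 0"
  proof
    assume "k' = 0"
    then have "p c0 = p c1" using p[of c0] p[of c1] by simp
    then have "E (p c0) c0" "E (p c0) c1" using p[of c0] p[of c1] by simp_all
    then show False using no_triangle[of "p c0" c0 c1] a(1) sym by blast
  qed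
  then obtain k'' where k'': "k' = Suc k''" by (cases k') auto
  have C3: "icyc [c3, c4, c5, c6, c0, c1, c2]"
    using heptagon_rotate[OF heptagon_rotate[OF heptagon_rotate[OF C]]] .
  have "E (p c0) (p c3)"
    using heptagon_dist_3[OF C, of r k'' p] l p unfolding k' k'' by blast
  moreover have "E (p c3) (p c6)"
    by (rule heptagon_dist_3[OF C3, of r k'' p]) (use l p k' k'' in auto)
  moreover have "E (p c6) c6" "E (p c0) c0" using p by auto
  ultimately show False using no_closed_5_walk[of "p c0" "p c3" "p c6" c6 c0] a sym by blast
qed

end

section \<open>From vertex lists to the arc lists of cycles in a \<open>pair_graph\<close>\<close>

section \<open>Transfer to graphs\<close>

lemma zip_tl_snoc:
  "xs \<noteq> [] \<Longrightarrow> zip xs (tl xs @ [y]) = zip xs (tl xs) @ [(last xs, y)]"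
proof (induction xs)
  case (Cons x xs)
  then show ?case by (cases xs) auto
qed simp

lemma awalk_of_verts:
  "pcas x (zip (x # xs) xs) (last (x # xs)) \<and> pawalk_verts x (zip (x # xs) xs) = x # xs"
proof (induction xs arbitrary: x)
  case (Cons y xs)
  show ?case using Cons[of y] by (cases xs) auto
qed simp

context pair_graph
begin

lemma graph_cycle_of_verts:
  assumes "distinct (x # xs)" "2 \<le> length xs"
    and e: "set (zip (x # xs) (xs @ [x])) \<subseteq> parcs G"
  shows "graph_cycle G (zip (x # xs) (xs @ [x]))"
proof -
  let ?p = "zip (x # xs) (xs @ [x])"
  \<comment> \<open>\<open>zip\<close> stops at the end of the shorter list, so the closing vertex
    can be appended on the left too, which is the shape that \<open>awalk_of_verts\<close>
    expects.\<close>
  have p: "?p = zip (x # (xs @ [x])) (xs @ [x])"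
    using zip_append1[of "x # xs" "[x]" "xs @ [x]"] by simp
  have "pcas x ?p x" "pawalk_verts x ?p = x # xs @ [x]"
    unfolding p using awalk_of_verts[of x "xs @ [x]"] by simp_all
  moreover have "(x, hd xs) \<in> parcs G" using e assms(2) by (cases xs) auto
  then have "x \<in> pverts G" by (rule in_arcsD1)
  ultimately have "cycle ?p"
    unfolding cycle_def awalk_def using assms by auto
  then show ?thesis using assms(2) unfolding graph_cycle_def by simp
qed

text \<open>The arcs join successive vertices, the last one leading back to \<open>x\<close>. By
  \<open>edges\<close> these arcs and their reverses are all the arcs among the vertices, which is
  what makes the cycle induced.\<close>

lemma hole_of_icyc:
  assumes "symmetric_relation (\<lambda>u v. (u, v) \<in> parcs G)"
    and "symmetric_relation.icyc (\<lambda>u v. (u, v) \<in> parcs G) cs"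
  shows "\<exists>p. hole G p \<and> length p = length cs"
proof -
  interpret R: symmetric_relation "\<lambda>u v. (u, v) \<in> parcs G" by (rule assms(1))
  obtain x xs where cs: "cs = x # xs" using assms(2) unfolding R.icyc_def by (cases cs) auto
  have c: "3 \<le> length xs" "R.ipath xs" "x \<notin> set xs"
    "\<And>y. y \<in> set xs \<Longrightarrow> (x, y) \<in> parcs G \<longleftrightarrow> y = hd xs \<or> y = last xs"
    using assms(2) unfolding cs R.icyc_Cons by auto
  have ne: "xs \<noteq> []" using c(1) by auto
  let ?p = "zip (x # xs) (xs @ [x])"
  let ?Z = "zip xs (tl xs)"
  have p: "?p = (x, hd xs) # ?Z @ [(last xs, x)]"
    using zip_tl_snoc[OF ne, of x] ne by (cases xs) auto
  have Z: "set ?Z \<subseteq> set xs \<times> set xs"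
    using set_zip_leftD set_zip_rightD list.set_sel(2)[OF ne] by fastforce
  have edges: "(u, v) \<in> parcs G \<longleftrightarrow> (u, v) \<in> set ?p \<or> (v, u) \<in> set ?p"
    if uv: "u \<in> set (x # xs)" "v \<in> set (x # xs)" for u v
  proof -
    consider "u \<in> set xs" "v \<in> set xs" | "u = x" "v = x" | "u = x" "v \<in> set xs" | "u \<in> set xs" "v = x"
      using uv by auto
    then show ?thesis
    proof cases
      case 1
      then have "u \<noteq> x" "v \<noteq> x" using c(3) by auto
      then show ?thesis unfolding p using R.ipath_edges[OF c(2) 1] by auto
    next
      case 2
      then show ?thesis unfolding p using R.irrefl Z c(3) ne by auto
    next
      case 3
      then have "v \<noteq> x" using c(3) by auto
      then show ?thesis unfolding p using 3 c(3) c(4)[of v] Z by auto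
    next
      case 4
      then have "u \<noteq> x" using c(3) by auto
      then show ?thesis unfolding p using 4 c(3) c(4)[of u] Z R.sym_iff[of u x] by auto
    qed
  qed
  have sub: "set ?p \<subseteq> set (x # xs) \<times> set (x # xs)"
    unfolding p using Z ne by auto
  have "graph_cycle G ?p"
  proof (rule graph_cycle_of_verts)
    show "distinct (x # xs)" using c(3) R.ipath_distinct[OF c(2)] by simp
    show "2 \<le> length xs" using c(1) by simp
    show "set ?p \<subseteq> parcs G" using edges sub by auto
  qed
  moreover have "fst ` set ?p = set (x # xs)"
    using map_fst_zip[of "x # xs" "xs @ [x]"] by (metis length_Cons length_append_singleton list.set_map)
  then have "arcs (with_proj G \<restriction> (fst ` set ?p)) = set ?p \<union> (set ?p)\<inverse>"
    using edges sub by (auto simp: induce_subgraph_def)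
  ultimately have "hole G ?p" using c(1) unfolding hole_def induced_cycle_def by simp
  then show ?thesis unfolding cs by (intro exI[of _ ?p]) simp
qed

end

theorem theorem1p1:
  fixes G :: "'a pair_pre_digraph"
  assumes "pair_graph G"
    and "5 \<le> girth G"
    and "\<not> (\<exists>p. odd_hole G p \<and> 9 \<le> length p)"
  shows "chromatic_number G \<le> 1456 \<and>
         ((\<not> (\<exists>p. k_hole 5 G p)) \<longrightarrow> chromatic_number G \<le> 4)"
proof -
  interpret pair_graph G by (rule assms(1))
  let ?E = "\<lambda>u v. (u, v) \<in> parcs G"
  have sym: "?E x y \<Longrightarrow> ?E y x" for x y
    using pair_sym_arcs unfolding symmetric_def with_proj_simps by (rule symD)
  have irr: "\<not> ?E x x" for x using pair_no_loops by fastforce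
  have S: "symmetric_relation ?E" using sym irr by unfold_locales blast+
  have girth: "\<not> (graph_cycle G p \<and> (length p = 3 \<or> length p = 4))" for p
    using assms(2) unfolding girth_ge_5_iff by blast
  have "long_odd_hole_free ?E"
  proof (intro long_odd_hole_free.intro S long_odd_hole_free_axioms.intro)
    show "\<not> ?E z x" if "?E x y" "?E y z" for x y z
    proof
      assume "?E z x"
      then have "distinct [x, y, z]" using that irr by auto
      then have "graph_cycle G [(x, y), (y, z), (z, x)]"
        using graph_cycle_of_verts[of x "[y, z]"] that \<open>?E z x\<close> by auto
      then show False using girth[of "[(x, y), (y, z), (z, x)]"] by simp
    qed
    show "b = d" if "?E a b" "?E b c" "?E c d" "?E d a" "a \<noteq> c" for a b c d
    proof (rule ccontr)
      assume "b \<noteq> d"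
      then have "distinct [a, b, c, d]" using that irr by auto
      then have "graph_cycle G [(a, b), (b, c), (c, d), (d, a)]"
        using graph_cycle_of_verts[of a "[b, c, d]"] that by auto
      then show False using girth[of "[(a, b), (b, c), (c, d), (d, a)]"] by simp
    qed
    show "length cs < 9" if "symmetric_relation.icyc ?E cs" "odd (length cs)" for cs
      using hole_of_icyc[OF S that(1)] that(2) assms(3) unfolding odd_hole_def
      by (metis not_le)
    have "{x. \<exists>y. ?E x y} \<subseteq> pverts G" using in_arcsD1 by blast
    then show "finite {x. \<exists>y. ?E x y}" using pair_finite_verts finite_subset by blast
  qed
  then interpret F: long_odd_hole_free ?E .
  \<comment> \<open>The relation is defined on the whole type, and a colouring of the whole type
    restricts to \<open>pverts G\<close>.\<close>
  have chi: "chromatic_number G \<le> n" if "F.colorable UNIV n" for n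
  proof -
    obtain c where "\<forall>v. c v < n" "\<forall>u v. ?E u v \<longrightarrow> c u \<noteq> (c v :: nat)"
      using \<open>F.colorable UNIV n\<close> unfolding F.colorable_def by auto
    then have "proper_coloring G n c" unfolding proper_coloring_def by auto
    then show ?thesis unfolding chromatic_number_def by (blast intro: Least_le)
  qed
  \<comment> \<open>Two colour sets, one for each parity of the level, give 2 * 2 = 4 colours here
    and 2 * 728 = 1456 in general.\<close>
  have "chromatic_number G \<le> 4" if no5: "\<not> (\<exists>p. k_hole 5 G p)"
  proof -
    interpret H: heptagonal ?E
      using hole_of_icyc[OF S] no5 unfolding k_hole_def by unfold_locales metis
    show ?thesis using chi F.colorable_from_levels[OF H.level_2_colorable] by simp
  qed
  then show ?thesis using chi F.colorable_from_levels[OF F.level_728_colorable] by simp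
qed

end
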